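(* Let $T$ be a theory (a set of sentences of the language of arithmetic). If $T$ is a consistent and recursively axiomatizable extension of Robinson arithmetic $Q$, then $T$ is incomplete, i.e. there is a sentence $\sigma$ such that $T\not\vdash\sigma$ and $T\not\vdash\neg\sigma$.
   Context: Fix a standard first-order language of arithmetic (with equality, constant $0$, unary function symbol $s$, binary function symbols $+,\cdot$, order $\le$ primitive or defined) and a standard Gödel numbering. A theory is an arbitrary set of sentences of this language. $Q$ is Robinson arithmetic, with axioms $s(x)\neq 0$; $s(x)=s(y)\to x=y$; $x\ne0\to\exists y\,(x=s(y))$; $x+0=x$; $x+s(y)=s(x+y)$; $x\cdot 0=0$; $x\cdot s(y)=x\cdot y+x$; $x\le y\leftrightarrow\exists z\,(z+x=y)$. An extension of $Q$ is a theory (in the same language) proving all axioms of $Q$. A theory is recursively axiomatizable if it has the same theorems as some theory whose set of Gödel numbers is recursive. *)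

theory Defs
  imports Main "HOL-Library.Nat_Bijection"
begin

section \<open>The language of arithmetic\<close>

text \<open>Variables are de Bruijn indices: in a formula, index \<open>i\<close> occurring below \<open>k\<close> quantifiers is
  bound if \<open>i < k\<close> and denotes the free variable number \<open>i - k\<close> otherwise.  The order is a primitive
  relation symbol.\<close>

datatype tm = Var nat | Zero | Succ tm | Add tm tm | Mul tm tm

datatype fm = Eq tm tm | Le tm tm | Neg fm | Imp fm fm | All fm

definition Conj :: "fm \<Rightarrow> fm \<Rightarrow> fm" where
  "Conj \<phi> \<psi> = Neg (Imp \<phi> (Neg \<psi>))"

definition Iff :: "fm \<Rightarrow> fm \<Rightarrow> fm" where
  "Iff \<phi> \<psi> = Conj (Imp \<phi> \<psi>) (Imp \<psi> \<phi>)"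

definition Ex :: "fm \<Rightarrow> fm" where
  "Ex \<phi> = Neg (All (Neg \<phi>))"

primrec fv_tm :: "tm \<Rightarrow> nat set" where
  "fv_tm (Var i) = {i}"
| "fv_tm Zero = {}"
| "fv_tm (Succ t) = fv_tm t"
| "fv_tm (Add s t) = fv_tm s \<union> fv_tm t"
| "fv_tm (Mul s t) = fv_tm s \<union> fv_tm t"

primrec fv :: "fm \<Rightarrow> nat set" where
  "fv (Eq s t) = fv_tm s \<union> fv_tm t"
| "fv (Le s t) = fv_tm s \<union> fv_tm t"
| "fv (Neg \<phi>) = fv \<phi>"
| "fv (Imp \<phi> \<psi>) = fv \<phi> \<union> fv \<psi>"
| "fv (All \<phi>) = {i. Suc i \<in> fv \<phi>}"

definition sentence :: "fm \<Rightarrow> bool" where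
  "sentence \<phi> \<longleftrightarrow> fv \<phi> = {}"

definition theory_of_sentences :: "fm set \<Rightarrow> bool" where
  "theory_of_sentences T \<longleftrightarrow> (\<forall>\<phi>\<in>T. sentence \<phi>)"

text \<open>\<open>lift k\<close> inserts a fresh variable at index \<open>k\<close>.\<close>

primrec lift_tm :: "nat \<Rightarrow> tm \<Rightarrow> tm" where
  "lift_tm k (Var i) = (if i < k then Var i else Var (Suc i))"
| "lift_tm k Zero = Zero"
| "lift_tm k (Succ t) = Succ (lift_tm k t)"
| "lift_tm k (Add s t) = Add (lift_tm k s) (lift_tm k t)"
| "lift_tm k (Mul s t) = Mul (lift_tm k s) (lift_tm k t)"

primrec lift :: "nat \<Rightarrow> fm \<Rightarrow> fm" where
  "lift k (Eq s t) = Eq (lift_tm k s) (lift_tm k t)"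
| "lift k (Le s t) = Le (lift_tm k s) (lift_tm k t)"
| "lift k (Neg \<phi>) = Neg (lift k \<phi>)"
| "lift k (Imp \<phi> \<psi>) = Imp (lift k \<phi>) (lift k \<psi>)"
| "lift k (All \<phi>) = All (lift (Suc k) \<phi>)"

text \<open>\<open>subst k u\<close> replaces the variable of index \<open>k\<close> by \<open>u\<close> (without capture) and removes the index
  \<open>k\<close>, so that \<open>subst 0 u \<phi>\<close> is the instance for \<open>u\<close> of the body of \<open>All \<phi>\<close>.\<close>

primrec subst_tm :: "nat \<Rightarrow> tm \<Rightarrow> tm \<Rightarrow> tm" where
  "subst_tm k u (Var i) = (if i < k then Var i else if i = k then u else Var (i - 1))"
| "subst_tm k u Zero = Zero"
| "subst_tm k u (Succ t) = Succ (subst_tm k u t)"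
| "subst_tm k u (Add s t) = Add (subst_tm k u s) (subst_tm k u t)"
| "subst_tm k u (Mul s t) = Mul (subst_tm k u s) (subst_tm k u t)"

primrec subst :: "nat \<Rightarrow> tm \<Rightarrow> fm \<Rightarrow> fm" where
  "subst k u (Eq s t) = Eq (subst_tm k u s) (subst_tm k u t)"
| "subst k u (Le s t) = Le (subst_tm k u s) (subst_tm k u t)"
| "subst k u (Neg \<phi>) = Neg (subst k u \<phi>)"
| "subst k u (Imp \<phi> \<psi>) = Imp (subst k u \<phi>) (subst k u \<psi>)"
| "subst k u (All \<phi>) = All (subst (Suc k) (lift_tm 0 u) \<phi>)"


section \<open>Provability\<close>

text \<open>A Hilbert calculus for classical first-order logic with equality.  Generalization is unrestricted,
  which is sound because it is only used for sets \<open>T\<close> of sentences.\<close>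

inductive proves :: "fm set \<Rightarrow> fm \<Rightarrow> bool" (infix "\<turnstile>" 50) for T :: "fm set" where
  Hyp: "\<phi> \<in> T \<Longrightarrow> T \<turnstile> \<phi>"
| Ax_K: "T \<turnstile> Imp \<phi> (Imp \<psi> \<phi>)"
| Ax_S: "T \<turnstile> Imp (Imp \<phi> (Imp \<psi> \<chi>)) (Imp (Imp \<phi> \<psi>) (Imp \<phi> \<chi>))"
| Ax_contrapos: "T \<turnstile> Imp (Imp (Neg \<phi>) (Neg \<psi>)) (Imp \<psi> \<phi>)"
| Ax_inst: "T \<turnstile> Imp (All \<phi>) (subst 0 t \<phi>)"
| Ax_distrib: "T \<turnstile> Imp (All (Imp \<phi> \<psi>)) (Imp (All \<phi>) (All \<psi>))"
| Ax_vacuous: "T \<turnstile> Imp \<phi> (All (lift 0 \<phi>))"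
| Ax_refl: "T \<turnstile> Eq t t"
| Ax_Leibniz: "T \<turnstile> Imp (Eq s t) (Imp (subst 0 s \<phi>) (subst 0 t \<phi>))"
| MP: "T \<turnstile> Imp \<phi> \<psi> \<Longrightarrow> T \<turnstile> \<phi> \<Longrightarrow> T \<turnstile> \<psi>"
| Gen: "T \<turnstile> \<phi> \<Longrightarrow> T \<turnstile> All \<phi>"

definition theorems_of :: "fm set \<Rightarrow> fm set" where
  "theorems_of T = {\<phi>. sentence \<phi> \<and> T \<turnstile> \<phi>}"

definition consistent :: "fm set \<Rightarrow> bool" where
  "consistent T \<longleftrightarrow> \<not> (\<exists>\<phi>. T \<turnstile> \<phi> \<and> T \<turnstile> Neg \<phi>)"


section \<open>Robinson arithmetic\<close>

text \<open>The axioms are universally closed; in those with two outer quantifiers, \<open>Var 1\<close> is \<open>x\<close> and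
  \<open>Var 0\<close> is \<open>y\<close>, and both indices go up by one below a further quantifier.\<close>

definition robinson_Q :: "fm set" where
  "robinson_Q =
    {All (Neg (Eq (Succ (Var 0)) Zero)),
     All (All (Imp (Eq (Succ (Var 1)) (Succ (Var 0))) (Eq (Var 1) (Var 0)))),
     All (Imp (Neg (Eq (Var 0) Zero)) (Ex (Eq (Var 1) (Succ (Var 0))))),
     All (Eq (Add (Var 0) Zero) (Var 0)),
     All (All (Eq (Add (Var 1) (Succ (Var 0))) (Succ (Add (Var 1) (Var 0))))),
     All (Eq (Mul (Var 0) Zero) Zero),
     All (All (Eq (Mul (Var 1) (Succ (Var 0))) (Add (Mul (Var 1) (Var 0)) (Var 1)))),
     All (All (Iff (Le (Var 1) (Var 0)) (Ex (Eq (Add (Var 0) (Var 2)) (Var 1)))))}"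

definition extends_Q :: "fm set \<Rightarrow> bool" where
  "extends_Q T \<longleftrightarrow> (\<forall>\<phi>\<in>robinson_Q. T \<turnstile> \<phi>)"


section \<open>Goedel numbering\<close>

primrec code_tm :: "tm \<Rightarrow> nat" where
  "code_tm (Var i) = prod_encode (0, i)"
| "code_tm Zero = prod_encode (1, 0)"
| "code_tm (Succ t) = prod_encode (2, code_tm t)"
| "code_tm (Add s t) = prod_encode (3, prod_encode (code_tm s, code_tm t))"
| "code_tm (Mul s t) = prod_encode (4, prod_encode (code_tm s, code_tm t))"

primrec code_fm :: "fm \<Rightarrow> nat" where
  "code_fm (Eq s t) = prod_encode (0, prod_encode (code_tm s, code_tm t))"
| "code_fm (Le s t) = prod_encode (1, prod_encode (code_tm s, code_tm t))"
| "code_fm (Neg \<phi>) = prod_encode (2, code_fm \<phi>)"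
| "code_fm (Imp \<phi> \<psi>) = prod_encode (3, prod_encode (code_fm \<phi>, code_fm \<psi>))"
| "code_fm (All \<phi>) = prod_encode (4, code_fm \<phi>)"

lemma code_tm_inject: "code_tm s = code_tm t \<longleftrightarrow> s = t"
proof (induction s arbitrary: t)
  case (Var i) then show ?case by (cases t) auto
next
  case Zero then show ?case by (cases t) auto
next
  case (Succ s) then show ?case by (cases t) auto
next
  case (Add s1 s2) then show ?case by (cases t) auto
next
  case (Mul s1 s2) then show ?case by (cases t) auto
qed

lemma code_fm_inject: "code_fm \<phi> = code_fm \<psi> \<longleftrightarrow> \<phi> = \<psi>"
proof (induction \<phi> arbitrary: \<psi>)
  case (Eq s t) then show ?case by (cases \<psi>) (auto simp: code_tm_inject)
next
  case (Le s t) then show ?case by (cases \<psi>) (auto simp: code_tm_inject)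
next
  case (Neg \<phi>) then show ?case by (cases \<psi>) auto
next
  case (Imp \<phi>1 \<phi>2) then show ?case by (cases \<psi>) auto
next
  case (All \<phi>) then show ?case by (cases \<psi>) auto
qed


section \<open>Recursive functions and sets\<close>

text \<open>\<open>recursive_fn n f\<close>: the restriction of \<open>f\<close> to lists of length \<open>n\<close> is a total recursive \<open>n\<close>-ary
  function.  By \<open>cong\<close>, the values of \<open>f\<close> on lists of other lengths are irrelevant.  Minimization
  is restricted to regular functions, so that all functions stay total.\<close>

inductive recursive_fn :: "nat \<Rightarrow> (nat list \<Rightarrow> nat) \<Rightarrow> bool" where
  zero: "recursive_fn n (\<lambda>xs. 0)"
| succ: "recursive_fn 1 (\<lambda>xs. Suc (xs ! 0))"
| proj: "i < n \<Longrightarrow> recursive_fn n (\<lambda>xs. xs ! i)"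
| comp: "recursive_fn (length hs) g \<Longrightarrow> (\<forall>h\<in>set hs. recursive_fn n h) \<Longrightarrow>
    recursive_fn n (\<lambda>xs. g (map (\<lambda>h. h xs) hs))"
| prim_rec: "recursive_fn n g \<Longrightarrow> recursive_fn (Suc (Suc n)) h \<Longrightarrow>
    recursive_fn (Suc n) (\<lambda>xs. rec_nat (g (tl xs)) (\<lambda>y r. h (y # r # tl xs)) (hd xs))"
| minim: "recursive_fn (Suc n) f \<Longrightarrow> (\<forall>xs. length xs = n \<longrightarrow> (\<exists>y. f (y # xs) = 0)) \<Longrightarrow>
    recursive_fn n (\<lambda>xs. LEAST y. f (y # xs) = 0)"
| cong: "recursive_fn n f \<Longrightarrow> (\<forall>xs. length xs = n \<longrightarrow> g xs = f xs) \<Longrightarrow> recursive_fn n g"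

definition recursive_set :: "nat set \<Rightarrow> bool" where
  "recursive_set A \<longleftrightarrow> recursive_fn 1 (\<lambda>xs. if xs ! 0 \<in> A then 1 else 0)"

definition recursively_axiomatizable :: "fm set \<Rightarrow> bool" where
  "recursively_axiomatizable T \<longleftrightarrow>
    (\<exists>T'. theory_of_sentences T' \<and> recursive_set (code_fm ` T') \<and> theorems_of T' = theorems_of T)"

end

theory Submission imports Defs begin

text \<open>Rosser's argument, without a computable substitution function and without completeness of the
  calculus.  If \<open>T\<close> has a recursive set of axioms, then for \<open>n = \<ulcorner>\<alpha>\<urcorner>\<close> the code of
  \<open>\<sigma>\<^sub>\<alpha> = \<forall>x. x = n \<longrightarrow> \<alpha>(x)\<close> is a simple function of \<open>n\<close>, and the sets of those \<open>n\<close> for which \<open>T\<close> proves,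
  respectively refutes, \<open>\<sigma>\<^sub>\<alpha>\<close> are disjoint and \<open>\<Sigma>\<^sub>1\<close>.  Comparing witnesses yields one formula \<open>\<alpha>\<close> that \<open>Q\<close>
  refutes on the first set and proves on the second; its own \<open>\<sigma>\<^sub>\<alpha>\<close> is undecided.

  That provability is \<open>\<Sigma>\<^sub>1\<close> needs no arithmetization of algorithms: substitution, the calculus and
  primitive recursion are all least sets closed under \<open>\<Sigma>\<^sub>1\<close> rules with at most two premises, and such a set
  is \<open>\<Sigma>\<^sub>1\<close> because a derivation is a finite set of numbers.\<close>

section \<open>Propositional valuations\<close>

text \<open>Since \<open>T\<close> is only assumed consistent, possibly unsound, it would not be
  enough that \<open>\<alpha>\<close> is true of the right numbers: \<open>Q\<close> must decide it,
  in opposite senses, on the two sets. \<open>Q\<close> has no induction, so all inductions run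
  outside it, on numerals, and what it knows about an arbitrary element comes from comparing it with
  one fixed numeral.

  Valuations ignore quantifiers: \<open>v (Ex \<phi>)\<close> supplies no witness, and truth of all
  instances does not give \<open>v (All \<phi>)\<close>. Quantifiers are therefore handled by
  returning to provability and starting again from an arbitrary valuation, where facts about the old
  one survive only if they are written into the formula.

  The guard x = n stands in for putting the numeral into \<open>\<alpha>\<close>: it leaves the code
  of \<open>\<alpha>\<close> intact inside the code of \<open>\<sigma>\<^sub>\<alpha>\<close>.
  Substitution then has to be described only for the axiom schemes of the calculus, where its graph
  is enough.\<close>

text \<open>Atomic and quantified formulas are treated as propositional variables, so that by \<open>pval_complete\<close>
  derivations can be replaced by reasoning about truth values.\<close>

definition pval :: "fm set \<Rightarrow> (fm \<Rightarrow> bool) \<Rightarrow> bool" where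
  "pval T v \<longleftrightarrow> (\<forall>\<phi>. v (Neg \<phi>) \<longleftrightarrow> \<not> v \<phi>) \<and> (\<forall>\<phi> \<psi>. v (Imp \<phi> \<psi>) \<longleftrightarrow> (v \<phi> \<longrightarrow> v \<psi>)) \<and>
     (\<forall>\<phi>. T \<turnstile> \<phi> \<longrightarrow> v \<phi>)"

text \<open>Generalization is left out: only so does the deduction theorem hold for open formulas
  without a side condition.\<close>

definition mp_closed :: "fm set \<Rightarrow> fm set \<Rightarrow> bool" where
  "mp_closed T M \<longleftrightarrow> (\<forall>\<phi>. T \<turnstile> \<phi> \<longrightarrow> \<phi> \<in> M) \<and> (\<forall>\<phi> \<psi>. Imp \<phi> \<psi> \<in> M \<longrightarrow> \<phi> \<in> M \<longrightarrow> \<psi> \<in> M)"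

lemma mp_closedD:
  assumes "mp_closed T M"
  shows "T \<turnstile> \<phi> \<Longrightarrow> \<phi> \<in> M" and "Imp \<phi> \<psi> \<in> M \<Longrightarrow> \<phi> \<in> M \<Longrightarrow> \<psi> \<in> M"
  using assms unfolding mp_closed_def by blast+

lemma Imp_refl: "T \<turnstile> Imp \<phi> \<phi>"
  by (rule proves.MP[OF proves.MP[OF proves.Ax_S proves.Ax_K] proves.Ax_K[where \<psi> = \<phi>]])

lemma mp_closed_extend:
  assumes "mp_closed T M"
  shows "mp_closed T {\<chi>. Imp \<phi> \<chi> \<in> M}" "M \<subseteq> {\<chi>. Imp \<phi> \<chi> \<in> M}" "\<phi> \<in> {\<chi>. Imp \<phi> \<chi> \<in> M}"
proof -
  note ax = mp_closedD(1)[OF assms] and mp = mp_closedD(2)[OF assms]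
  show sub: "M \<subseteq> {\<chi>. Imp \<phi> \<chi> \<in> M}"
    using mp[OF ax[OF proves.Ax_K]] by auto
  show "mp_closed T {\<chi>. Imp \<phi> \<chi> \<in> M}"
    unfolding mp_closed_def using sub ax mp[OF mp[OF ax[OF proves.Ax_S]]] by auto
  show "\<phi> \<in> {\<chi>. Imp \<phi> \<chi> \<in> M}"
    using ax[OF Imp_refl] by simp
qed

text \<open>Assuming \<open>\<phi>\<close> means passing to
  \<open>{\<chi>. Imp \<phi> \<chi> \<in> M}\<close>, which is again closed by \<open>Ax_S\<close>;
  this is the deduction theorem.\<close>

lemma mp_closed_ImpI:
  assumes "mp_closed T M" and "\<And>M'. mp_closed T M' \<Longrightarrow> M \<subseteq> M' \<Longrightarrow> \<phi> \<in> M' \<Longrightarrow> \<psi> \<in> M'"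
  shows "Imp \<phi> \<psi> \<in> M"
  using assms(2)[OF mp_closed_extend[OF assms(1), of \<phi>]] by simp

lemma mp_closed_explosion:
  assumes "mp_closed T M" "\<phi> \<in> M" "Neg \<phi> \<in> M" shows "\<psi> \<in> M"
proof -
  note ax = mp_closedD(1)[OF assms(1)] and mp = mp_closedD(2)[OF assms(1)]
  have "Imp (Neg \<psi>) (Neg \<phi>) \<in> M" using mp[OF ax[OF proves.Ax_K] assms(3)] .
  then show ?thesis using mp[OF mp[OF ax[OF proves.Ax_contrapos]]] assms(2) by blast
qed

text \<open>Under \<open>Neg \<phi>\<close> everything follows, in particular the negation of the
  theorem \<open>?\<chi>\<close>; \<open>Ax_contrapos\<close> turns this into
  \<open>Imp ?\<chi> \<phi>\<close>.\<close>

lemma mp_closed_clavius: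
  assumes M: "mp_closed T M" and "Imp (Neg \<phi>) \<phi> \<in> M" shows "\<phi> \<in> M"
proof -
  let ?\<chi> = "Imp \<phi> \<phi>"
  have "Imp (Neg \<phi>) (Neg ?\<chi>) \<in> M"
  proof (rule mp_closed_ImpI[OF M])
    fix M' assume "mp_closed T M'" "M \<subseteq> M'" "Neg \<phi> \<in> M'"
    then show "Neg ?\<chi> \<in> M'"
      using assms(2) mp_closedD(2) mp_closed_explosion by blast
  qed
  then show ?thesis
    using mp_closedD(2)[OF M mp_closedD(2)[OF M mp_closedD(1)[OF M proves.Ax_contrapos]]]
      mp_closedD(1)[OF M Imp_refl] by blast
qed

lemma mp_closed_double_neg:
  assumes M: "mp_closed T M" and "Neg (Neg \<phi>) \<in> M" shows "\<phi> \<in> M"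
  by (rule mp_closed_clavius[OF M], rule mp_closed_ImpI[OF M])
    (use assms(2) mp_closed_explosion in blast)

lemma mp_closed_cases:
  assumes M: "mp_closed T M" and "Imp \<phi> \<chi> \<in> M" "Imp (Neg \<phi>) \<chi> \<in> M" shows "\<chi> \<in> M"
proof (rule mp_closed_clavius[OF M], rule mp_closed_ImpI[OF M])
  fix M' assume M': "mp_closed T M'" "M \<subseteq> M'" "Neg \<chi> \<in> M'"
  have "Neg \<phi> \<in> M'"
  proof (rule mp_closed_clavius[OF M'(1)], rule mp_closed_ImpI[OF M'(1)])
    fix M'' assume M'': "mp_closed T M''" "M' \<subseteq> M''" "Neg (Neg \<phi>) \<in> M''"
    then have "\<phi> \<in> M''" using mp_closed_double_neg by blast
    then have "\<chi> \<in> M''" using M'' M' assms(2) mp_closedD(2) by blast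
    then show "Neg \<phi> \<in> M''" using M'' M' mp_closed_explosion by blast
  qed
  then show "\<chi> \<in> M'" using M' assms(3) mp_closedD(2) by blast
qed

lemma mp_closed_peirce:
  assumes M: "mp_closed T M" and "Imp (Imp \<phi> \<psi>) \<chi> \<in> M" "Imp \<phi> \<chi> \<in> M" shows "\<chi> \<in> M"
proof (rule mp_closed_cases[OF M assms(3)], rule mp_closed_ImpI[OF M])
  fix M' assume M': "mp_closed T M'" "M \<subseteq> M'" "Neg \<phi> \<in> M'"
  have "Imp \<phi> \<psi> \<in> M'"
    by (rule mp_closed_ImpI[OF M'(1)]) (use M'(3) mp_closed_explosion in blast)
  then show "\<chi> \<in> M'" using M' assms(2) mp_closedD(2) by blast
qed

text \<open>Lindenbaum's construction with \<open>\<phi>\<close> in the place of falsity: membership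
  in a maximal closed set that omits \<open>\<phi>\<close> is a valuation.\<close>

lemma pval_complete:
  assumes "\<And>v. pval T v \<Longrightarrow> v \<phi>"
  shows "T \<turnstile> \<phi>"
proof (rule ccontr)
  assume np: "\<not> T \<turnstile> \<phi>"
  let ?A = "{M. mp_closed T M \<and> \<phi> \<notin> M}"
  have "\<exists>M\<in>?A. \<forall>X\<in>?A. M \<subseteq> X \<longrightarrow> X = M"
  proof (rule subset_Zorn_nonempty)
    have "mp_closed T {\<psi>. T \<turnstile> \<psi>}" unfolding mp_closed_def using proves.MP by blast
    then show "?A \<noteq> {}" using np by blast
    fix C assume C: "C \<noteq> {}" "subset.chain ?A C"
    have "mp_closed T (\<Union>C)"
      unfolding mp_closed_def
    proof (intro conjI allI impI)
      fix \<psi> assume "T \<turnstile> \<psi>" then show "\<psi> \<in> \<Union>C"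
        using C unfolding subset.chain_def mp_closed_def by blast
    next
      fix \<psi> \<chi> assume "Imp \<psi> \<chi> \<in> \<Union>C" "\<psi> \<in> \<Union>C"
      then obtain M1 M2 where "M1 \<in> C" "M2 \<in> C" "Imp \<psi> \<chi> \<in> M1" "\<psi> \<in> M2" by blast
      moreover from this C(2) have "M1 \<subseteq> M2 \<or> M2 \<subseteq> M1" unfolding subset.chain_def by blast
      ultimately obtain M where M: "M \<in> C" "Imp \<psi> \<chi> \<in> M" "\<psi> \<in> M" by blast
      then have "mp_closed T M" using C(2) unfolding subset.chain_def by blast
      then show "\<chi> \<in> \<Union>C" using M mp_closedD(2) by blast
    qed
    then show "\<Union>C \<in> ?A" using C unfolding subset.chain_def by blast
  qed
  then obtain M where M: "mp_closed T M" "\<phi> \<notin> M"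
    and max: "\<And>X. mp_closed T X \<Longrightarrow> \<phi> \<notin> X \<Longrightarrow> M \<subseteq> X \<Longrightarrow> X = M" by blast
  \<comment> \<open>Otherwise \<open>{\<chi>. Imp \<psi> \<chi> \<in> M}\<close> would be a proper
    closed extension of \<open>M\<close> still omitting \<open>\<phi>\<close>.\<close>
  have out: "Imp \<psi> \<phi> \<in> M" if "\<psi> \<notin> M" for \<psi>
    using max[OF mp_closed_extend(1)[OF M(1), of \<psi>]] mp_closed_extend(2,3)[OF M(1), of \<psi>] that by blast
  have "pval T (\<lambda>\<psi>. \<psi> \<in> M)"
    unfolding pval_def
  proof (intro conjI allI iffI impI notI)
    fix \<psi> assume "Neg \<psi> \<in> M" "\<psi> \<in> M" then show False using M mp_closed_explosion by blast
  next
    fix \<psi> assume "\<psi> \<notin> M" then show "Neg \<psi> \<in> M" using out M mp_closed_cases by blast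
  next
    fix \<psi> \<chi> assume "Imp \<psi> \<chi> \<in> M" "\<psi> \<in> M" then show "\<chi> \<in> M" using M mp_closedD by blast
  next
    fix \<psi> \<chi> assume *: "\<psi> \<in> M \<longrightarrow> \<chi> \<in> M"
    show "Imp \<psi> \<chi> \<in> M"
    proof (cases "\<psi> \<in> M")
      case True
      then show ?thesis using * mp_closedD(2)[OF M(1) mp_closedD(1)[OF M(1) proves.Ax_K]] by blast
    next
      case False
      then show ?thesis using out M mp_closed_peirce by blast
    qed
  next
    fix \<psi> assume "T \<turnstile> \<psi>" then show "\<psi> \<in> M" using M mp_closedD by blast
  qed
  then show False using assms M(2) by blast
qed

lemma pval_simps:
  assumes "pval T v"
  shows "v (Neg \<phi>) \<longleftrightarrow> \<not> v \<phi>" "v (Imp \<phi> \<psi>) \<longleftrightarrow> (v \<phi> \<longrightarrow> v \<psi>)"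
    "v (Conj \<phi> \<psi>) \<longleftrightarrow> v \<phi> \<and> v \<psi>" "v (Iff \<phi> \<psi>) \<longleftrightarrow> (v \<phi> \<longleftrightarrow> v \<psi>)"
  using assms unfolding pval_def Conj_def Iff_def by auto

lemma pval_thm: "pval T v \<Longrightarrow> T \<turnstile> \<phi> \<Longrightarrow> v \<phi>"
  unfolding pval_def by blast

section \<open>Quantifiers and equality under a valuation\<close>

lemma lift_subst_tm [simp]: "subst_tm k u (lift_tm k t) = t"
  by (induction t) auto

lemma All_inst: "T \<turnstile> All \<phi> \<Longrightarrow> T \<turnstile> subst 0 t \<phi>"
  using proves.Ax_inst proves.MP by blast

lemma pval_inst: "pval T v \<Longrightarrow> v (All \<phi>) \<Longrightarrow> v (subst 0 t \<phi>)"
  using pval_thm[OF _ proves.Ax_inst] pval_simps(2) by blast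

lemma subst_Ex: "subst k u (Ex \<phi>) = Ex (subst (Suc k) (lift_tm 0 u) \<phi>)"
  by (simp add: Ex_def)

lemma pval_ExI: "pval T v \<Longrightarrow> v (subst 0 t \<phi>) \<Longrightarrow> v (Ex \<phi>)"
  using pval_inst[of T v "Neg \<phi>" t] by (auto simp: Ex_def pval_simps)

text \<open>The step is demanded for every valuation, so that it becomes a theorem and can be
  generalized over its variable 0, the witness. Whatever is known about \<open>v\<close> alone must
  enter \<open>\<psi>\<close> as an antecedent; hence the implications to which this rule is applied
  later.\<close>

lemma pval_ExE:
  assumes "v (Ex \<phi>)" and v: "pval T v"
    and step: "\<And>w. pval T w \<Longrightarrow> w \<phi> \<Longrightarrow> w (lift 0 \<psi>)"
  shows "v \<psi>"
proof (rule ccontr)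
  assume "\<not> v \<psi>"
  have "T \<turnstile> Imp (Neg (lift 0 \<psi>)) (Neg \<phi>)"
    by (rule pval_complete) (use step in \<open>auto simp: pval_simps\<close>)
  then have "T \<turnstile> Imp (All (lift 0 (Neg \<psi>))) (All (Neg \<phi>))"
    using proves.MP[OF proves.Ax_distrib proves.Gen] by simp
  moreover have "v (All (lift 0 (Neg \<psi>)))"
    using pval_thm[OF v proves.Ax_vacuous] \<open>\<not> v \<psi>\<close> v pval_simps by blast
  ultimately show False
    using v assms(1) pval_thm[OF v, of "Imp (All (lift 0 (Neg \<psi>))) (All (Neg \<phi>))"]
    by (simp add: Ex_def pval_simps[OF v])
qed

lemma pval_leibniz: "pval T v \<Longrightarrow> v (Eq s t) \<Longrightarrow> v (subst 0 s \<phi>) \<Longrightarrow> v (subst 0 t \<phi>)"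
  using pval_thm[OF _ proves.Ax_Leibniz] pval_simps(2) by blast

lemma pval_refl: "pval T v \<Longrightarrow> v (Eq t t)"
  using pval_thm[OF _ proves.Ax_refl] .

text \<open>In the contexts given to Leibniz' axiom here and below, \<open>Var 0\<close> marks the
  place that is rewritten and \<open>lift_tm 0\<close> shields the other terms.\<close>

lemma pval_sym: "pval T v \<Longrightarrow> v (Eq s t) \<Longrightarrow> v (Eq t s)"
  using pval_leibniz[of T v s t "Eq (Var 0) (lift_tm 0 s)"] pval_refl[of T v] by simp

lemma pval_trans: "pval T v \<Longrightarrow> v (Eq s t) \<Longrightarrow> v (Eq t u) \<Longrightarrow> v (Eq s u)"
  using pval_leibniz[of T v t u "Eq (lift_tm 0 s) (Var 0)"] by simp

lemma pval_Succ: "pval T v \<Longrightarrow> v (Eq s t) \<Longrightarrow> v (Eq (Succ s) (Succ t))"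
  using pval_leibniz[of T v s t "Eq (Succ (lift_tm 0 s)) (Succ (Var 0))"] pval_refl[of T v] by simp

lemma pval_Add: "pval T v \<Longrightarrow> v (Eq s t) \<Longrightarrow> v (Eq s' t') \<Longrightarrow> v (Eq (Add s s') (Add t t'))"
  using pval_leibniz[of T v s t "Eq (Add (lift_tm 0 s) (lift_tm 0 s')) (Add (Var 0) (lift_tm 0 s'))"]
    pval_leibniz[of T v s' t' "Eq (Add (lift_tm 0 s) (lift_tm 0 s')) (Add (lift_tm 0 t) (Var 0))"]
    pval_refl[of T v] by simp

lemma pval_Mul: "pval T v \<Longrightarrow> v (Eq s t) \<Longrightarrow> v (Eq s' t') \<Longrightarrow> v (Eq (Mul s s') (Mul t t'))"
  using pval_leibniz[of T v s t "Eq (Mul (lift_tm 0 s) (lift_tm 0 s')) (Mul (Var 0) (lift_tm 0 s'))"]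
    pval_leibniz[of T v s' t' "Eq (Mul (lift_tm 0 s) (lift_tm 0 s')) (Mul (lift_tm 0 t) (Var 0))"]
    pval_refl[of T v] by simp

lemma pval_Le: "pval T v \<Longrightarrow> v (Eq s t) \<Longrightarrow> v (Eq s' t') \<Longrightarrow> v (Le s s') \<longleftrightarrow> v (Le t t')"
  using pval_leibniz[of T v s t "Le (Var 0) (lift_tm 0 s')"]
    pval_leibniz[of T v s' t' "Le (lift_tm 0 t) (Var 0)"]
    pval_leibniz[of T v t s "Le (Var 0) (lift_tm 0 s')"]
    pval_leibniz[of T v t' s' "Le (lift_tm 0 t) (Var 0)"] pval_sym by fastforce

lemma pval_Eq: "pval T v \<Longrightarrow> v (Eq s t) \<Longrightarrow> v (Eq s' t') \<Longrightarrow> v (Eq s s') \<longleftrightarrow> v (Eq t t')"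
  using pval_sym pval_trans by blast

section \<open>Reasoning in Robinson arithmetic\<close>

primrec num :: "nat \<Rightarrow> tm" where
  "num 0 = Zero"
| "num (Suc n) = Succ (num n)"

lemma num_closed [simp]: "lift_tm k (num n) = num n" "subst_tm k u (num n) = num n" "fv_tm (num n) = {}"
  by (induction n) auto

abbreviation Q :: "fm set" where "Q \<equiv> robinson_Q"

lemma Q_axioms:
  assumes v: "pval Q v"
  shows Q_Succ_Zero: "\<not> v (Eq (Succ s) Zero)"
    and Q_Succ_inject: "v (Eq (Succ s) (Succ t)) \<Longrightarrow> v (Eq s t)"
    and Q_pred: "v (Eq s Zero) \<or> v (Ex (Eq (lift_tm 0 s) (Succ (Var 0))))"
    and Q_Add_Zero: "v (Eq (Add s Zero) s)"
    and Q_Add_Succ: "v (Eq (Add s (Succ t)) (Succ (Add s t)))"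
    and Q_Mul_Zero: "v (Eq (Mul s Zero) Zero)"
    and Q_Mul_Succ: "v (Eq (Mul s (Succ t)) (Add (Mul s t) s))"
    and Q_Le: "v (Le s t) \<longleftrightarrow> v (Ex (Eq (Add (Var 0) (lift_tm 0 s)) (lift_tm 0 t)))"
proof -
  have ax1: "v (subst 0 s \<phi>)" if "All \<phi> \<in> Q" for \<phi> s
    by (rule pval_thm[OF v]) (rule All_inst[OF proves.Hyp[OF that]])
  have ax2: "v (subst 0 t (subst 1 (lift_tm 0 s) \<phi>))" if "All (All \<phi>) \<in> Q" for \<phi> s t
    using pval_thm[OF v All_inst[OF All_inst[OF proves.Hyp[OF that], of s, simplified]], of t] by simp
  note [simp] = pval_simps[OF v] subst_Ex
  show "\<not> v (Eq (Succ s) Zero)"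
    using ax1[of "Neg (Eq (Succ (Var 0)) Zero)" s] by (simp add: robinson_Q_def)
  show "v (Eq s Zero) \<or> v (Ex (Eq (lift_tm 0 s) (Succ (Var 0))))"
    using ax1[of "Imp (Neg (Eq (Var 0) Zero)) (Ex (Eq (Var 1) (Succ (Var 0))))" s]
    by (auto simp: robinson_Q_def)
  show "v (Eq (Add s Zero) s)"
    using ax1[of "Eq (Add (Var 0) Zero) (Var 0)" s] by (simp add: robinson_Q_def)
  show "v (Eq (Mul s Zero) Zero)"
    using ax1[of "Eq (Mul (Var 0) Zero) Zero" s] by (simp add: robinson_Q_def)
  show "v (Eq (Succ s) (Succ t)) \<Longrightarrow> v (Eq s t)"
    using ax2[of "Imp (Eq (Succ (Var 1)) (Succ (Var 0))) (Eq (Var 1) (Var 0))" t s]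
    by (simp add: robinson_Q_def)
  show "v (Eq (Add s (Succ t)) (Succ (Add s t)))"
    using ax2[of "Eq (Add (Var 1) (Succ (Var 0))) (Succ (Add (Var 1) (Var 0)))" t s]
    by (simp add: robinson_Q_def)
  show "v (Eq (Mul s (Succ t)) (Add (Mul s t) s))"
    using ax2[of "Eq (Mul (Var 1) (Succ (Var 0))) (Add (Mul (Var 1) (Var 0)) (Var 1))" t s]
    by (simp add: robinson_Q_def)
  \<comment> \<open>The order axiom has an inner quantifier, below which the term for x has been
    lifted twice when y is instantiated.\<close>
  have "subst_tm (Suc 0) (lift_tm 0 t) (lift_tm 0 (lift_tm 0 s)) = lift_tm 0 s" for s
    by (induction s) auto
  then show "v (Le s t) \<longleftrightarrow> v (Ex (Eq (Add (Var 0) (lift_tm 0 s)) (lift_tm 0 t)))"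
    using ax2[of "Iff (Le (Var 1) (Var 0)) (Ex (Eq (Add (Var 0) (Var 2)) (Var 1)))" t s]
    by (auto simp add: robinson_Q_def Iff_def Conj_def numeral_2_eq_2)
qed

lemma Q_num_neq: "pval Q v \<Longrightarrow> v (Eq (num m) (num n)) \<longleftrightarrow> m = n"
proof (induction m arbitrary: n)
  case 0
  show ?case
    using Q_Succ_Zero[OF 0] pval_sym[OF 0] pval_refl[OF 0] by (cases n) auto
next
  case (Suc m)
  show ?case
  proof (cases n)
    case 0
    then show ?thesis using Q_Succ_Zero[OF Suc(2)] by simp
  next
    case (Suc n')
    have "v (Eq (Succ (num m)) (Succ (num n'))) \<longleftrightarrow> v (Eq (num m) (num n'))"
      using Q_Succ_inject[OF Suc.prems] pval_Succ[OF Suc.prems] by blast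
    then show ?thesis using Suc Suc.IH[OF Suc.prems] by simp
  qed
qed

lemma Q_num_Add: "pval Q v \<Longrightarrow> v (Eq (Add (num m) (num n)) (num (m + n)))"
proof (induction n)
  case 0 then show ?case using Q_Add_Zero by simp
next
  case (Suc n)
  then show ?case
    using pval_trans[OF Suc(2) Q_Add_Succ[OF Suc(2)] pval_Succ[OF Suc(2)]] by simp
qed

lemma Q_num_Mul: "pval Q v \<Longrightarrow> v (Eq (Mul (num m) (num n)) (num (m * n)))"
proof (induction n)
  case 0 then show ?case using Q_Mul_Zero by simp
next
  case (Suc n)
  have "v (Eq (Add (Mul (num m) (num n)) (num m)) (num (m * n + m)))"
    using pval_trans[OF Suc(2) pval_Add[OF Suc(2) Suc(1)[OF Suc(2)] pval_refl[OF Suc(2)]] Q_num_Add[OF Suc(2)]] .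
  then show ?case
    using pval_trans[OF Suc(2) Q_Mul_Succ[OF Suc(2)]] by (simp add: add.commute)
qed

section \<open>Evaluation of terms and instances by numerals\<close>

primrec evalt :: "(nat \<Rightarrow> nat) \<Rightarrow> tm \<Rightarrow> nat" where
  "evalt e (Var i) = e i"
| "evalt e Zero = 0"
| "evalt e (Succ t) = Suc (evalt e t)"
| "evalt e (Add s t) = evalt e s + evalt e t"
| "evalt e (Mul s t) = evalt e s * evalt e t"

text \<open>In \<open>msub\<close> and \<open>ren\<close>, \<open>k\<close> is the number of binders passed; \<open>msub 0 e\<close> closes every formula.\<close>

primrec msub_tm :: "nat \<Rightarrow> (nat \<Rightarrow> nat) \<Rightarrow> tm \<Rightarrow> tm" where
  "msub_tm k e (Var i) = (if i < k then Var i else num (e (i - k)))"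
| "msub_tm k e Zero = Zero"
| "msub_tm k e (Succ t) = Succ (msub_tm k e t)"
| "msub_tm k e (Add s t) = Add (msub_tm k e s) (msub_tm k e t)"
| "msub_tm k e (Mul s t) = Mul (msub_tm k e s) (msub_tm k e t)"

primrec msub :: "nat \<Rightarrow> (nat \<Rightarrow> nat) \<Rightarrow> fm \<Rightarrow> fm" where
  "msub k e (Eq s t) = Eq (msub_tm k e s) (msub_tm k e t)"
| "msub k e (Le s t) = Le (msub_tm k e s) (msub_tm k e t)"
| "msub k e (Neg \<phi>) = Neg (msub k e \<phi>)"
| "msub k e (Imp \<phi> \<psi>) = Imp (msub k e \<phi>) (msub k e \<psi>)"
| "msub k e (All \<phi>) = All (msub (Suc k) e \<phi>)"

primrec ren_tm :: "nat \<Rightarrow> (nat \<Rightarrow> nat) \<Rightarrow> tm \<Rightarrow> tm" where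
  "ren_tm k r (Var i) = (if i < k then Var i else Var (k + r (i - k)))"
| "ren_tm k r Zero = Zero"
| "ren_tm k r (Succ t) = Succ (ren_tm k r t)"
| "ren_tm k r (Add s t) = Add (ren_tm k r s) (ren_tm k r t)"
| "ren_tm k r (Mul s t) = Mul (ren_tm k r s) (ren_tm k r t)"

primrec ren :: "nat \<Rightarrow> (nat \<Rightarrow> nat) \<Rightarrow> fm \<Rightarrow> fm" where
  "ren k r (Eq s t) = Eq (ren_tm k r s) (ren_tm k r t)"
| "ren k r (Le s t) = Le (ren_tm k r s) (ren_tm k r t)"
| "ren k r (Neg \<phi>) = Neg (ren k r \<phi>)"
| "ren k r (Imp \<phi> \<psi>) = Imp (ren k r \<phi>) (ren k r \<psi>)"
| "ren k r (All \<phi>) = All (ren (Suc k) r \<phi>)"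

lemma msub_ren_tm: "msub_tm k e (ren_tm k r t) = msub_tm k (\<lambda>i. e (r i)) t"
  by (induction t) auto

lemma msub_ren: "msub k e (ren k r \<phi>) = msub k (\<lambda>i. e (r i)) \<phi>"
  by (induction \<phi> arbitrary: k) (auto simp: msub_ren_tm)

lemma subst_msub_tm: "subst_tm k (num n) (msub_tm (Suc k) e t) = msub_tm k (case_nat n e) t"
proof (induction t)
  case (Var i)
  consider "i < k" | "i = k" | j where "i = Suc (k + j)"
    by (metis less_imp_Suc_add linorder_neqE_nat)
  then show ?case by cases (auto simp: Suc_diff_le)
qed auto

text \<open>Used at \<open>k = 0\<close>, where instantiating a quantifier by a numeral becomes an
  extension of the environment; general \<open>k\<close> serves the induction.\<close>

lemma subst_msub: "subst k (num n) (msub (Suc k) e \<phi>) = msub k (case_nat n e) \<phi>"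
  by (induction \<phi> arbitrary: k) (auto simp: subst_msub_tm)

lemma fv_msub_tm: "fv_tm (msub_tm k e t) \<subseteq> {..<k}"
  by (induction t) auto

lemma fv_msub: "fv (msub k e \<phi>) \<subseteq> {..<k}"
proof (induction \<phi> arbitrary: k)
  case (Eq s t) then show ?case using fv_msub_tm by simp
next
  case (Le s t) then show ?case using fv_msub_tm by simp
next
  case (All \<phi>) then show ?case using All[of "Suc k"] by auto
qed auto

lemma subst_Var0_tm: "fv_tm t \<subseteq> {..<Suc k} \<Longrightarrow> subst_tm k (Var k) t = t"
  by (induction t) auto

lemma subst_Var0: "fv \<phi> \<subseteq> {..<Suc k} \<Longrightarrow> subst k (Var k) \<phi> = \<phi>"
proof (induction \<phi> arbitrary: k)
  case (All \<phi>)
  have "fv \<phi> \<subseteq> {..<Suc (Suc k)}"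
  proof
    fix i assume "i \<in> fv \<phi>"
    then show "i \<in> {..<Suc (Suc k)}" using All(2) by (cases i) auto
  qed
  then show ?case using All(1) by simp
qed (auto simp: subst_Var0_tm)

text \<open>Leibniz' axiom with the variable itself as one of the terms: a formula with no free
  variable but 0 is its own instance at \<open>Var 0\<close>. This replaces the generic element of a
  proof by generalization with a numeral.\<close>

lemma pval_eq_num:
  assumes v: "pval T v" and "v (Eq (Var 0) (num n))" "fv \<phi> \<subseteq> {0}"
  shows "v \<phi> \<longleftrightarrow> v (subst 0 (num n) \<phi>)"
  using pval_leibniz[OF v assms(2), of \<phi>] pval_leibniz[OF v pval_sym[OF v assms(2)], of \<phi>]
    subst_Var0[of \<phi> 0] assms(3) by (auto simp: lessThan_Suc)

lemma Q_eval_tm: "pval Q v \<Longrightarrow> v (Eq (msub_tm 0 e t) (num (evalt e t)))"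
proof (induction t)
  case (Add s t)
  then show ?case using pval_trans[OF Add(3) pval_Add[OF Add(3)] Q_num_Add[OF Add(3)]] by simp
next
  case (Mul s t)
  then show ?case using pval_trans[OF Mul(3) pval_Mul[OF Mul(3)] Q_num_Mul[OF Mul(3)]] by simp
qed (auto simp: pval_refl pval_Succ)

text \<open>The disjunction of t = 0, ..., t = n - 1, falsity being the empty one. It has to be a
  formula, not a quantifier of the metalogic, in order to be a conclusion of
  \<open>pval_ExE\<close>.\<close>

primrec below :: "nat \<Rightarrow> tm \<Rightarrow> fm" where
  "below 0 t = Neg (Eq Zero Zero)"
| "below (Suc n) t = Imp (Neg (below n t)) (Eq t (num n))"

lemma pval_below: "pval T v \<Longrightarrow> v (below n t) \<longleftrightarrow> (\<exists>i<n. v (Eq t (num i)))"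
  by (induction n) (auto simp: pval_simps pval_refl less_Suc_eq)

lemma lift_below [simp]: "lift k (below n t) = below n (lift_tm k t)"
  by (induction n) auto

lemma below_Succ:
  assumes "pval Q v" "v (below n t)" "v (Eq s (Succ t))" shows "v (below (Suc n) s)"
proof -
  obtain i where "i < n" "v (Eq t (num i))" using assms by (auto simp: pval_below)
  then have "v (Eq s (num (Suc i)))" "Suc i < Suc n"
    using pval_trans[OF assms(1) assms(3) pval_Succ[OF assms(1)]] by auto
  then show ?thesis unfolding pval_below[OF assms(1)] by blast
qed

text \<open>Induction outside \<open>Q\<close>: a nonzero \<open>t\<close> is S y, and z + S y = S
  (z + y) is impossible when the bound is 0, while for the bound S n injectivity yields z + y = n,
  that is, y \<le> n.\<close>

lemma Q_Le_num: "pval Q v \<Longrightarrow> v (Le t (num n)) \<Longrightarrow> v (below (Suc n) t)"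
proof (induction n arbitrary: v t)
  case (0 v t)
  note v = 0(1)
  show ?case
  proof (rule disjE[OF Q_pred[OF v, of t]])
    assume "v (Eq t Zero)" then show ?thesis using v by (simp add: pval_simps)
  next
    assume t: "v (Ex (Eq (lift_tm 0 t) (Succ (Var 0))))"
    have "v (Imp (Le t Zero) (below 1 t))"
    proof (rule pval_ExE[OF t v])
      fix w assume w: "pval Q w" "w (Eq (lift_tm 0 t) (Succ (Var 0)))"
      have "\<not> w (Le (lift_tm 0 t) Zero)"
      proof
        assume "w (Le (lift_tm 0 t) Zero)"
        then have "w (Ex (Eq (Add (Var 0) (lift_tm 0 (lift_tm 0 t))) Zero))"
          using Q_Le[OF w(1), of "lift_tm 0 t" Zero] by simp
        \<comment> \<open>The equation t = S y is known to \<open>w\<close> only, so it is carried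
          along as an antecedent.\<close>
        then have "w (Imp (Eq (lift_tm 0 t) (Succ (Var 0))) (Neg (Eq Zero Zero)))"
        proof (rule pval_ExE[OF _ w(1)])
          fix u assume u: "pval Q u" "u (Eq (Add (Var 0) (lift_tm 0 (lift_tm 0 t))) Zero)"
          have "\<not> u (Eq (lift_tm 0 (lift_tm 0 t)) (Succ (Var 1)))"
            using pval_trans[OF u(1) pval_Add[OF u(1) pval_refl[OF u(1)]] Q_Add_Succ[OF u(1)]]
              Q_Succ_Zero[OF u(1)] pval_sym[OF u(1)] pval_trans[OF u(1)] u(2) by blast
          then show "u (lift 0 (Imp (Eq (lift_tm 0 t) (Succ (Var 0))) (Neg (Eq Zero Zero))))"
            using u(1) by (simp add: pval_simps)
        qed
        then show False using w pval_refl[OF w(1)] by (simp add: pval_simps)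
      qed
      then show "w (lift 0 (Imp (Le t Zero) (below 1 t)))" using w(1) by (simp add: pval_simps)
    qed
    then show ?thesis using 0 by (simp add: pval_simps)
  qed
next
  case (Suc n v t)
  note v = Suc(2)
  show ?case
  proof (rule disjE[OF Q_pred[OF v, of t]])
    assume "v (Eq t Zero)" then show ?thesis using pval_below[OF v] num.simps(1) by fastforce
  next
    assume t: "v (Ex (Eq (lift_tm 0 t) (Succ (Var 0))))"
    have "v (Imp (Le t (num (Suc n))) (below (Suc (Suc n)) t))"
    proof (rule pval_ExE[OF t v])
      fix w assume w: "pval Q w" "w (Eq (lift_tm 0 t) (Succ (Var 0)))"
      have "w (below (Suc (Suc n)) (lift_tm 0 t))" if "w (Le (lift_tm 0 t) (num (Suc n)))"
      proof -
        have "w (Ex (Eq (Add (Var 0) (lift_tm 0 (lift_tm 0 t))) (num (Suc n))))"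
          using that Q_Le[OF w(1), of "lift_tm 0 t" "num (Suc n)"] by (simp del: num.simps)
        then have "w (Imp (Eq (lift_tm 0 t) (Succ (Var 0))) (Le (Var 0) (num n)))"
        proof (rule pval_ExE[OF _ w(1)])
          \<comment> \<open>For \<open>u\<close>, \<open>Var 0\<close> is the summand z of the order
            axiom and \<open>Var 1\<close> the predecessor of \<open>t\<close>.\<close>
          fix u assume u: "pval Q u" "u (Eq (Add (Var 0) (lift_tm 0 (lift_tm 0 t))) (num (Suc n)))"
          have "u (Le (Var 1) (num n))" if "u (Eq (lift_tm 0 (lift_tm 0 t)) (Succ (Var 1)))"
          proof -
            have "u (Eq (Add (Var 0) (lift_tm 0 (lift_tm 0 t))) (Succ (Add (Var 0) (Var 1))))"
              using pval_trans[OF u(1) pval_Add[OF u(1) pval_refl[OF u(1)] that] Q_Add_Succ[OF u(1)]] .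
            then have "u (Eq (Succ (Add (Var 0) (Var 1))) (Succ (num n)))"
              using u(2) pval_sym[OF u(1)] pval_trans[OF u(1)] by (metis num.simps(2))
            then have "u (subst 0 (Var 0) (Eq (Add (Var 0) (Var 2)) (num n)))"
              using Q_Succ_inject[OF u(1)] by (simp add: numeral_2_eq_2)
            then show ?thesis
              using pval_ExI[OF u(1)] Q_Le[OF u(1), of "Var 1" "num n"] by (fastforce simp: numeral_2_eq_2)
          qed
          then show "u (lift 0 (Imp (Eq (lift_tm 0 t) (Succ (Var 0))) (Le (Var 0) (num n))))"
            using u(1) by (simp add: pval_simps)
        qed
        then have "w (Le (Var 0) (num n))" using w by (simp add: pval_simps)
        then show ?thesis using Suc(1)[OF w(1)] below_Succ[OF w(1) _ w(2)] by blast
      qed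
      then show "w (lift 0 (Imp (Le t (num (Suc n))) (below (Suc (Suc n)) t)))"
        using w(1) by (simp add: pval_simps del: below.simps num.simps)
    qed
    then show ?thesis using Suc(2,3) by (simp add: pval_simps del: below.simps num.simps)
  qed
qed

lemma Q_Le_iff: "pval Q v \<Longrightarrow> v (Le (num m) (num n)) \<longleftrightarrow> m \<le> n"
proof
  assume v: "pval Q v" and "v (Le (num m) (num n))"
  then show "m \<le> n" using Q_Le_num[OF v] Q_num_neq[OF v] pval_below[OF v] by (metis less_Suc_eq_le)
next
  assume v: "pval Q v" and "m \<le> n"
  then have "v (subst 0 (num (n - m)) (Eq (Add (Var 0) (num m)) (num n)))"
    using Q_num_Add[OF v, of "n - m" m] by simp
  then show "v (Le (num m) (num n))"
    using pval_ExI[OF v] Q_Le[OF v, of "num m" "num n"] by (simp del: subst.simps)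
qed

text \<open>The orientation z + x = y of the order axiom matters, as \<open>Q\<close> does not prove
  that addition commutes: t + 0 = t gives 0 \<le> t, and z + S n = S (z + n) carries n \<le> y over
  to S n \<le> S y.\<close>

lemma Q_num_Le: "pval Q v \<Longrightarrow> v (below n t) \<or> v (Le (num n) t)"
proof (induction n arbitrary: v t)
  case (0 v t)
  have "v (subst 0 t (Eq (Add (Var 0) Zero) (lift_tm 0 t)))"
    using Q_Add_Zero[OF 0] by simp
  then show ?case using pval_ExI[OF 0] Q_Le[OF 0, of Zero t] by (simp del: subst.simps)
next
  case (Suc n v t)
  note v = Suc(2)
  show ?case
  proof (rule disjE[OF Q_pred[OF v, of t]])
    assume "v (Eq t Zero)" then show ?thesis using pval_below[OF v] num.simps(1) by fastforce
  next
    assume t: "v (Ex (Eq (lift_tm 0 t) (Succ (Var 0))))"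
    have "v (Imp (Neg (below (Suc n) t)) (Le (num (Suc n)) t))"
    proof (rule pval_ExE[OF t v])
      fix w assume w: "pval Q w" "w (Eq (lift_tm 0 t) (Succ (Var 0)))"
      have "w (Le (num (Suc n)) (lift_tm 0 t))" if "w (Le (num n) (Var 0))"
      proof -
        have "w (Ex (Eq (Add (Var 0) (num n)) (Var 1)))"
          using that Q_Le[OF w(1), of "num n" "Var 0"] by simp
        then have "w (Ex (Eq (Add (Var 0) (num (Suc n))) (Succ (Var 1))))"
        proof (rule pval_ExE[OF _ w(1)])
          fix u assume u: "pval Q u" "u (Eq (Add (Var 0) (num n)) (Var 1))"
          have "u (Eq (Add (Var 0) (num (Suc n))) (Succ (Var 1)))"
            using pval_trans[OF u(1) Q_Add_Succ[OF u(1)] pval_Succ[OF u(1) u(2)]] by simp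
          then have "u (Ex (Eq (Add (Var 0) (num (Suc n))) (Succ (Var 2))))"
            using pval_ExI[OF u(1), of "Var 0" "Eq (Add (Var 0) (num (Suc n))) (Succ (Var 2))"]
            by (simp add: numeral_2_eq_2)
          then show "u (lift 0 (Ex (Eq (Add (Var 0) (num (Suc n))) (Succ (Var 1)))))"
            by (simp add: Ex_def numeral_2_eq_2)
        qed
        then have "w (Le (num (Suc n)) (Succ (Var 0)))"
          using Q_Le[OF w(1), of "num (Suc n)" "Succ (Var 0)"] by simp
        then show ?thesis
          using pval_Le[OF w(1) pval_refl[OF w(1)] w(2)] by blast
      qed
      then have "w (below (Suc n) (lift_tm 0 t)) \<or> w (Le (num (Suc n)) (lift_tm 0 t))"
        using Suc(1)[OF w(1), of "Var 0"] below_Succ[OF w(1) _ w(2)] by blast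
      then show "w (lift 0 (Imp (Neg (below (Suc n) t)) (Le (num (Suc n)) t)))"
        using w(1) by (auto simp: pval_simps simp del: below.simps num.simps)
    qed
    then show ?thesis using Suc(2) by (auto simp add: pval_simps simp del: below.simps num.simps)
  qed
qed

lemma Q_mono:
  assumes "Q \<turnstile> \<phi>" "extends_Q T" shows "T \<turnstile> \<phi>"
  using assms(1) by induction (use assms(2) in \<open>auto simp: extends_Q_def intro: proves.intros\<close>)

section \<open>Decidable and \<open>\<Sigma>\<^sub>1\<close> predicates\<close>

abbreviation scons :: "nat \<Rightarrow> (nat \<Rightarrow> nat) \<Rightarrow> nat \<Rightarrow> nat" (infixr "\<triangleright>" 65) where
  "x \<triangleright> e \<equiv> case_nat x e"

text \<open>With this congruence rule, the simplifier does not rewrite below \<open>\<triangleright>\<close>.\<close>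
declare nat.case_cong_weak [cong del]

lemma scons_eta [simp]: "e 0 \<triangleright> (\<lambda>i. e (Suc i)) = e"
  by (rule ext) (simp split: nat.split)

lemma comp_scons: "(\<lambda>i. e ((j \<triangleright> r) i)) = e j \<triangleright> (\<lambda>i. e (r i))"
  by (rule ext) (simp split: nat.split)

text \<open>Predicates are over environments, so that \<open>P\<close> below may depend on any number of free variables.  \<open>Rep\<close>
  plays the role of \<open>\<Delta>\<^sub>0\<close>, and a \<open>\<Sigma>\<^sub>1\<close> predicate has a single leading unbounded quantifier.\<close>

definition Rep :: "((nat \<Rightarrow> nat) \<Rightarrow> bool) \<Rightarrow> bool" where
  "Rep P \<longleftrightarrow> (\<exists>\<phi>. \<forall>e. (P e \<longrightarrow> Q \<turnstile> msub 0 e \<phi>) \<and> (\<not> P e \<longrightarrow> Q \<turnstile> Neg (msub 0 e \<phi>)))"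

lemma RepI:
  assumes "\<And>e v. pval Q v \<Longrightarrow> v (msub 0 e \<phi>) \<longleftrightarrow> P e"
  shows "Rep P"
  unfolding Rep_def by (intro exI[of _ \<phi>]) (auto intro!: pval_complete simp: pval_simps assms)

lemma RepE:
  assumes "Rep P"
  obtains \<phi> where "\<And>e v. pval Q v \<Longrightarrow> v (msub 0 e \<phi>) \<longleftrightarrow> P e"
    "\<And>e. P e \<Longrightarrow> Q \<turnstile> msub 0 e \<phi>" "\<And>e. \<not> P e \<Longrightarrow> Q \<turnstile> Neg (msub 0 e \<phi>)"
proof -
  obtain \<phi> where *: "\<And>e. P e \<Longrightarrow> Q \<turnstile> msub 0 e \<phi>" "\<And>e. \<not> P e \<Longrightarrow> Q \<turnstile> Neg (msub 0 e \<phi>)"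
    using assms unfolding Rep_def by blast
  show ?thesis
    using that[OF _ *] pval_thm[OF _ *(1)] pval_thm[OF _ *(2)] pval_simps(1) by metis
qed

lemma Rep_eq: "Rep (\<lambda>e. evalt e s = evalt e t)"
proof (rule RepI[of "Eq s t"])
  fix e v assume v: "pval Q v"
  show "v (msub 0 e (Eq s t)) \<longleftrightarrow> evalt e s = evalt e t"
    using pval_Eq[OF v Q_eval_tm[OF v] Q_eval_tm[OF v]] by (simp add: Q_num_neq[OF v])
qed

lemma Rep_le: "Rep (\<lambda>e. evalt e s \<le> evalt e t)"
proof (rule RepI[of "Le s t"])
  fix e v assume v: "pval Q v"
  show "v (msub 0 e (Le s t)) \<longleftrightarrow> evalt e s \<le> evalt e t"
    using pval_Le[OF v Q_eval_tm[OF v] Q_eval_tm[OF v]] by (simp add: Q_Le_iff[OF v])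
qed

lemma Rep_imp: "Rep P \<Longrightarrow> Rep R \<Longrightarrow> Rep (\<lambda>e. P e \<longrightarrow> R e)"
  by (erule RepE, erule RepE, rule RepI[of "Imp _ _"]) (simp add: pval_simps)

lemma Rep_not: "Rep P \<Longrightarrow> Rep (\<lambda>e. \<not> P e)"
  by (erule RepE, rule RepI[of "Neg _"]) (simp add: pval_simps)

lemma Rep_conj: "Rep P \<Longrightarrow> Rep R \<Longrightarrow> Rep (\<lambda>e. P e \<and> R e)"
  using Rep_not[OF Rep_imp[OF _ Rep_not, of P R]] by simp

lemma Rep_disj: "Rep P \<Longrightarrow> Rep R \<Longrightarrow> Rep (\<lambda>e. P e \<or> R e)"
  using Rep_imp[OF Rep_not, of P R] by (simp add: disj_imp)

lemma Rep_ren: "Rep P \<Longrightarrow> Rep (\<lambda>e. P (\<lambda>i. e (r i)))"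
  by (erule RepE, rule RepI[of "ren 0 r _"]) (simp add: msub_ren)

text \<open>For a fixed numeral bound, \<open>Q_Le_num\<close> splits x \<le> m into finitely many
  equations, each leading to one instance.\<close>

lemma Q_bounded_All:
  assumes "fv \<phi> \<subseteq> {0}" and "\<And>n. n \<le> m \<Longrightarrow> Q \<turnstile> subst 0 (num n) \<phi>"
  shows "Q \<turnstile> All (Imp (Le (Var 0) (num m)) \<phi>)"
proof (rule proves.Gen, rule pval_complete)
  fix v assume v: "pval Q v"
  have "v \<phi>" if le: "v (Le (Var 0) (num m))"
  proof -
    obtain i where "i \<le> m" "v (Eq (Var 0) (num i))"
      using Q_Le_num[OF v le] pval_below[OF v] by (auto simp: less_Suc_eq_le simp del: below.simps)
    then show ?thesis
      using pval_eq_num[OF v _ assms(1)] pval_thm[OF v assms(2)] by blast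
  qed
  then show "v (Imp (Le (Var 0) (num m)) \<phi>)" using v by (simp add: pval_simps)
qed

text \<open>Truth of all numeral instances does not make a valuation accept \<open>All\<close>; in
  the true case the formula is therefore proved in \<open>Q\<close> outright. The converse is
  instantiation.\<close>

lemma Rep_ball_aux:
  assumes "Rep P" shows "Rep (\<lambda>e. \<forall>x\<le>e i. P (x \<triangleright> e))"
proof -
  obtain \<phi> where \<phi>: "\<And>e v. pval Q v \<Longrightarrow> v (msub 0 e \<phi>) \<longleftrightarrow> P e" "\<And>e. P e \<Longrightarrow> Q \<turnstile> msub 0 e \<phi>"
    using assms by (rule RepE) blast
  show ?thesis
  proof (rule RepI[of "All (Imp (Le (Var 0) (Var (Suc i))) \<phi>)"])
    fix e v assume v: "pval Q v"
    let ?\<psi> = "Imp (Le (Var 0) (num (e i))) (msub 1 e \<phi>)"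
    have "v (All ?\<psi>) \<longleftrightarrow> (\<forall>x\<le>e i. P (x \<triangleright> e))"
    proof
      assume *: "v (All ?\<psi>)"
      show "\<forall>x\<le>e i. P (x \<triangleright> e)"
      proof (intro allI impI)
        fix x assume "x \<le> e i"
        then show "P (x \<triangleright> e)"
          using pval_inst[OF v *, of "num x"] \<phi>(1)[OF v, of "x \<triangleright> e"]
          by (simp add: pval_simps[OF v] Q_Le_iff[OF v] subst_msub)
      qed
    next
      assume *: "\<forall>x\<le>e i. P (x \<triangleright> e)"
      have "Q \<turnstile> All ?\<psi>"
      proof (rule Q_bounded_All)
        show "fv (msub 1 e \<phi>) \<subseteq> {0}" using fv_msub[of 1 e \<phi>] by auto
        show "Q \<turnstile> subst 0 (num n) (msub 1 e \<phi>)" if "n \<le> e i" for n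
          using \<phi>(2)[of "n \<triangleright> e"] * that by (simp add: subst_msub)
      qed
      then show "v (All ?\<psi>)" using pval_thm[OF v] by blast
    qed
    then show "v (msub 0 e (All (Imp (Le (Var 0) (Var (Suc i))) \<phi>))) \<longleftrightarrow> (\<forall>x\<le>e i. P (x \<triangleright> e))"
      by simp
  qed
qed

text \<open>Splitting the body into bound value and old environment lets higher-order unification
  match the rule with ordinary bounded quantifiers; later rules have the same shape.\<close>

lemma Rep_ball: "Rep (\<lambda>e. P (e 0) (\<lambda>i. e (Suc i))) \<Longrightarrow> Rep (\<lambda>e. \<forall>x\<le>e i. P x e)"
  using Rep_ball_aux[of "\<lambda>e. P (e 0) (\<lambda>i. e (Suc i))" i] by simp

lemma Rep_bex: "Rep (\<lambda>e. P (e 0) (\<lambda>i. e (Suc i))) \<Longrightarrow> Rep (\<lambda>e. \<exists>x\<le>e i. P x e)"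
  using Rep_not[OF Rep_ball[of "\<lambda>x e. \<not> P x e", OF Rep_not]] by simp

section \<open>\<open>\<Sigma>\<^sub>1\<close> predicates and their closure properties\<close>

definition Sig :: "((nat \<Rightarrow> nat) \<Rightarrow> bool) \<Rightarrow> bool" where
  "Sig P \<longleftrightarrow> (\<exists>R. Rep R \<and> (\<forall>e. P e \<longleftrightarrow> (\<exists>b. R (b \<triangleright> e))))"

lemma SigI: "Rep R \<Longrightarrow> (\<And>e. P e \<longleftrightarrow> (\<exists>b. R (b \<triangleright> e))) \<Longrightarrow> Sig P"
  unfolding Sig_def by blast

lemma SigE:
  assumes "Sig P" obtains R where "Rep R" "P = (\<lambda>e. \<exists>b. R (b \<triangleright> e))"
  using assms unfolding Sig_def by (metis ext)

lemma Rep_insert: "Rep R \<Longrightarrow> Rep (\<lambda>e. R (e 0 \<triangleright> (\<lambda>i. e (Suc (Suc i)))))"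
  using Rep_ren[of R "0 \<triangleright> (\<lambda>i. Suc (Suc i))"] by (simp add: comp_scons)

lemma Sig_Rep: "Rep P \<Longrightarrow> Sig P"
  using SigI[OF Rep_ren[of P Suc]] by simp

lemma Sig_ren: "Sig P \<Longrightarrow> Sig (\<lambda>e. P (\<lambda>i. e (r i)))"
proof (erule SigE)
  fix R assume "Rep R" "P = (\<lambda>e. \<exists>b. R (b \<triangleright> e))"
  then show ?thesis
    using SigI[OF Rep_ren[of R "0 \<triangleright> (\<lambda>i. Suc (r i))"]] by (simp add: comp_scons)
qed

text \<open>One number bounding both witnesses is the new witness, and the old ones move under
  bounded quantifiers. \<open>Sig_ex_aux\<close> merges two quantifiers in the same way.\<close>

lemma Sig_conj: "Sig P \<Longrightarrow> Sig P' \<Longrightarrow> Sig (\<lambda>e. P e \<and> P' e)"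
proof (erule SigE, erule SigE)
  fix R R' assume R: "Rep R" "Rep R'" "P = (\<lambda>e. \<exists>b. R (b \<triangleright> e))" "P' = (\<lambda>e. \<exists>b. R' (b \<triangleright> e))"
  have "Rep (\<lambda>e. (\<exists>b\<le>e 0. R (b \<triangleright> (\<lambda>i. e (Suc i)))) \<and> (\<exists>b\<le>e 0. R' (b \<triangleright> (\<lambda>i. e (Suc i)))))"
    by (intro Rep_conj Rep_bex Rep_insert R)
  then show ?thesis
  proof (rule SigI)
    fix e
    show "(P e \<and> P' e) \<longleftrightarrow> (\<exists>b. (\<exists>x\<le>(b \<triangleright> e) 0. R (x \<triangleright> (\<lambda>i. (b \<triangleright> e) (Suc i)))) \<and>
        (\<exists>x\<le>(b \<triangleright> e) 0. R' (x \<triangleright> (\<lambda>i. (b \<triangleright> e) (Suc i)))))"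
      by (simp add: R(3,4)) (meson max.cobounded1 max.cobounded2)
  qed
qed

lemma Sig_disj: "Sig P \<Longrightarrow> Sig P' \<Longrightarrow> Sig (\<lambda>e. P e \<or> P' e)"
proof (erule SigE, erule SigE)
  fix R R' assume R: "Rep R" "Rep R'" "P = (\<lambda>e. \<exists>b. R (b \<triangleright> e))" "P' = (\<lambda>e. \<exists>b. R' (b \<triangleright> e))"
  show ?thesis by (rule SigI[OF Rep_disj[OF R(1,2)]]) (auto simp: R)
qed

lemma Sig_ex_aux: "Sig P \<Longrightarrow> Sig (\<lambda>e. \<exists>x. P (x \<triangleright> e))"
proof (erule SigE)
  fix R assume R: "Rep R" "P = (\<lambda>e. \<exists>b. R (b \<triangleright> e))"
  have "Rep (\<lambda>e. R (e 0 \<triangleright> e (Suc 0) \<triangleright> (\<lambda>i. e (Suc (Suc (Suc i))))))"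
    using Rep_ren[OF R(1), of "0 \<triangleright> Suc 0 \<triangleright> (\<lambda>i. Suc (Suc (Suc i)))"] by (simp add: comp_scons)
  then have "Rep (\<lambda>e. \<exists>x\<le>e 0. \<exists>b\<le>e 0. R (b \<triangleright> x \<triangleright> (\<lambda>i. e (Suc i))))"
    by (intro Rep_bex)
  then show ?thesis
  proof (rule SigI)
    fix e
    show "(\<exists>x. P (x \<triangleright> e)) \<longleftrightarrow> (\<exists>b. \<exists>x\<le>(b \<triangleright> e) 0. \<exists>b'\<le>(b \<triangleright> e) 0. R (b' \<triangleright> x \<triangleright> (\<lambda>i. (b \<triangleright> e) (Suc i))))"
      by (simp add: R(2)) (meson max.cobounded1 max.cobounded2)
  qed
qed

lemma Sig_ex: "Sig (\<lambda>e. P (e 0) (\<lambda>i. e (Suc i))) \<Longrightarrow> Sig (\<lambda>e. \<exists>x. P x e)"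
  using Sig_ex_aux[of "\<lambda>e. P (e 0) (\<lambda>i. e (Suc i))"] by simp

text \<open>Collection, carried out on actual numbers outside \<open>Q\<close>: finitely many
  witnesses have a maximum.\<close>

lemma Sig_ball_aux: "Sig P \<Longrightarrow> Sig (\<lambda>e. \<forall>x\<le>e i. P (x \<triangleright> e))"
proof (erule SigE)
  fix R assume R: "Rep R" "P = (\<lambda>e. \<exists>b. R (b \<triangleright> e))"
  have "Rep (\<lambda>e. R (e 0 \<triangleright> e (Suc 0) \<triangleright> (\<lambda>i. e (Suc (Suc (Suc i))))))"
    using Rep_ren[OF R(1), of "0 \<triangleright> Suc 0 \<triangleright> (\<lambda>i. Suc (Suc (Suc i)))"] by (simp add: comp_scons)
  then have "Rep (\<lambda>e. \<forall>x\<le>e (Suc i). \<exists>b\<le>e 0. R (b \<triangleright> x \<triangleright> (\<lambda>i. e (Suc i))))"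
    by (intro Rep_ball Rep_bex[where i = "Suc 0"])
  then show ?thesis
  proof (rule SigI)
    fix e
    have "\<exists>B. \<forall>x\<le>e i. \<exists>b\<le>B. R (b \<triangleright> x \<triangleright> e)" if "\<forall>x\<le>e i. \<exists>b. R (b \<triangleright> x \<triangleright> e)"
    proof -
      from that have "\<exists>f. \<forall>x\<in>{..e i}. R (f x \<triangleright> x \<triangleright> e)" by (intro bchoice) simp
      then obtain f where "\<forall>x\<le>e i. R (f x \<triangleright> x \<triangleright> e)" by auto
      moreover have "\<forall>x\<le>e i. f x \<le> Max (f ` {..e i})" by (intro allI impI Max_ge) auto
      ultimately show ?thesis by blast
    qed
    then show "(\<forall>x\<le>e i. P (x \<triangleright> e)) \<longleftrightarrow> (\<exists>b. \<forall>x\<le>(b \<triangleright> e) (Suc i). \<exists>b'\<le>(b \<triangleright> e) 0.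
        R (b' \<triangleright> x \<triangleright> (\<lambda>i. (b \<triangleright> e) (Suc i))))"
      by (auto simp add: R(2))
  qed
qed

lemma Sig_ball_var: "Sig (\<lambda>e. P (e 0) (\<lambda>i. e (Suc i))) \<Longrightarrow> Sig (\<lambda>e. \<forall>x\<le>e i. P x e)"
  using Sig_ball_aux[of "\<lambda>e. P (e 0) (\<lambda>i. e (Suc i))" i] by simp

section \<open>Total functions with \<open>\<Sigma>\<^sub>1\<close> graph\<close>

definition Fn :: "((nat \<Rightarrow> nat) \<Rightarrow> nat) \<Rightarrow> bool" where
  "Fn f \<longleftrightarrow> Sig (\<lambda>e. e 0 = f (\<lambda>i. e (Suc i)))"

lemma Fn_ren: "Fn f \<Longrightarrow> Fn (\<lambda>e. f (\<lambda>i. e (r i)))"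
  unfolding Fn_def using Sig_ren[of _ "0 \<triangleright> (\<lambda>i. Suc (r i))"] by fastforce

lemma Sig_subst1:
  assumes "Sig (\<lambda>e. P (e 0) (\<lambda>i. e (Suc i)))" "Fn f" shows "Sig (\<lambda>e. P (f e) e)"
  using Sig_ex[of "\<lambda>x e. x = f e \<and> P x e", OF Sig_conj] assms by (simp add: Fn_def)

lemma Fn_evalt: "Fn (\<lambda>e. evalt e t)"
proof -
  have "evalt e (ren_tm 0 Suc t) = evalt (\<lambda>i. e (Suc i)) t" for e
    by (induction t) auto
  then show ?thesis
    using Sig_Rep[OF Rep_eq[of "Var 0" "ren_tm 0 Suc t"]] by (simp add: Fn_def)
qed

lemma Fn_var: "Fn (\<lambda>e. e i)"
  using Fn_evalt[of "Var i"] by simp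

lemma evalt_num [simp]: "evalt e (num n) = n"
  by (induction n) auto

lemma Fn_const: "Fn (\<lambda>e. c)"
  using Fn_evalt[of "num c"] by simp

lemma Sig_subst2:
  assumes "Sig (\<lambda>e. R (e 0) (e 1))" "Fn f" "Fn g" shows "Sig (\<lambda>e. R (f e) (g e))"
proof (rule Sig_subst1[OF _ assms(2)], rule Sig_subst1[OF _ Fn_ren[OF assms(3)]])
  show "Sig (\<lambda>e. R (e (Suc 0)) (e 0))"
    using Sig_ren[OF assms(1), of "Suc 0 \<triangleright> (\<lambda>i. 0)"] by simp
qed

lemma Fn_subst1:
  assumes "Fn (\<lambda>e. F (e 0) (\<lambda>i. e (Suc i)))" "Fn f" shows "Fn (\<lambda>e. F (f e) e)"
proof -
  have "Sig (\<lambda>e. e (Suc 0) = F (e 0) (\<lambda>i. e (Suc (Suc i))))"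
    using Sig_ren[OF assms(1)[unfolded Fn_def], of "Suc 0 \<triangleright> 0 \<triangleright> (\<lambda>i. Suc (Suc i))"] by simp
  then show ?thesis
    unfolding Fn_def by (rule Sig_subst1) (rule Fn_ren[OF assms(2)])
qed

lemma Fn_subst2:
  assumes "Fn (\<lambda>e. F (e 0) (e 1))" "Fn f" "Fn g" shows "Fn (\<lambda>e. F (f e) (g e))"
proof (rule Fn_subst1[OF _ assms(2)], rule Fn_subst1[OF _ Fn_ren[OF assms(3)]])
  show "Fn (\<lambda>e. F (e (Suc 0)) (e 0))"
    using Fn_ren[OF assms(1), of "Suc 0 \<triangleright> (\<lambda>i. 0)"] by simp
qed

lemma Fn_Suc: "Fn f \<Longrightarrow> Fn (\<lambda>e. Suc (f e))"
  by (rule Fn_subst1[of "\<lambda>x e. Suc x"]) (use Fn_evalt[of "Succ (Var 0)"] in simp)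

text \<open>Doubling removes the division in the triangular number and leaves a polynomial equation,
  which is an atomic formula.\<close>

lemma prod_encode_eq_iff: "z = prod_encode (x, y) \<longleftrightarrow> z + z = (x + y) * Suc (x + y) + (x + x)"
proof -
  have "2 * triangle n = n * Suc n" for n
    unfolding triangle_def by (rule dvd_mult_div_cancel) simp
  then have "2 * prod_encode (x, y) = (x + y) * Suc (x + y) + 2 * x"
    by (simp add: prod_encode_def distrib_left)
  then show ?thesis by linarith
qed

lemma Fn_prod_encode: "Fn f \<Longrightarrow> Fn g \<Longrightarrow> Fn (\<lambda>e. prod_encode (f e, g e))"
proof (rule Fn_subst2[of "\<lambda>x y. prod_encode (x, y)"])
  let ?s = "Add (Var 1) (Var 2)"
  show "Fn (\<lambda>e. prod_encode (e 0, e 1))"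
    unfolding Fn_def prod_encode_eq_iff
    using Sig_Rep[OF Rep_eq[of "Add (Var 0) (Var 0)" "Add (Mul ?s (Succ ?s)) (Add (Var 1) (Var 1))"]]
    by (simp add: numeral_2_eq_2)
qed

lemma Sig_eq: "Fn f \<Longrightarrow> Fn g \<Longrightarrow> Sig (\<lambda>e. f e = g e)"
  by (rule Sig_subst2) (use Sig_Rep[OF Rep_eq[of "Var 0" "Var 1"]] in simp_all)

text \<open>\<open>Sig\<close> has no rule for negation, but the values of total functions can be
  computed first and compared afterwards. This is what makes minimization work below.\<close>

lemma Sig_neq: "Fn f \<Longrightarrow> Fn g \<Longrightarrow> Sig (\<lambda>e. f e \<noteq> g e)"
  by (rule Sig_subst2[of "(\<noteq>)"]) (use Sig_Rep[OF Rep_not[OF Rep_eq[of "Var 0" "Var 1"]]] in simp_all)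

lemma Sig_le: "Fn f \<Longrightarrow> Fn g \<Longrightarrow> Sig (\<lambda>e. f e \<le> g e)"
  by (rule Sig_subst2) (use Sig_Rep[OF Rep_le[of "Var 0" "Var 1"]] in simp_all)

lemma Sig_less: "Fn f \<Longrightarrow> Fn g \<Longrightarrow> Sig (\<lambda>e. f e < g e)"
  using Sig_le[OF Fn_Suc] by (simp add: Suc_le_eq)

lemma Sig_ball:
  assumes "Sig (\<lambda>e. P (e 0) (\<lambda>i. e (Suc i)))" "Fn f" shows "Sig (\<lambda>e. \<forall>x\<le>f e. P x e)"
proof (rule Sig_subst1[OF _ assms(2)], rule Sig_ball_var)
  show "Sig (\<lambda>e. P (e 0) (\<lambda>i. e (Suc (Suc i))))"
    using Sig_ren[OF assms(1), of "0 \<triangleright> (\<lambda>i. Suc (Suc i))"] by simp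
qed

lemmas Sig_intros = Sig_conj Sig_disj Sig_ex Sig_ball Sig_eq Sig_neq Sig_le Sig_less
  Fn_var Fn_const Fn_Suc Fn_prod_encode

text \<open>Composition substitutes for any number of variables at once. Here this is done one slot
  at a time; \<open>?P\<close> keeps slot \<open>m\<close> open as the argument that
  \<open>Sig_subst1\<close> fills.\<close>

lemma Sig_subst:
  assumes "Sig P" "\<And>i. i < m \<Longrightarrow> Fn (F i)"
  shows "Sig (\<lambda>e. P (\<lambda>i. if i < m then F i e else e (i - m)))"
  using assms
proof (induction m arbitrary: F)
  case 0 then show ?case by simp
next
  case (Suc m)
  let ?P = "\<lambda>x e. P (\<lambda>i. if i < m then F i e else if i = m then x else e (i - Suc m))"
  have "Sig (\<lambda>e. P (\<lambda>i. if i < m then F i (\<lambda>j. e (Suc j)) else e (i - m)))"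
    using Suc.IH[of "\<lambda>i e. F i (\<lambda>j. e (Suc j))"] Suc.prems Fn_ren by simp
  also have "(\<lambda>e. P (\<lambda>i. if i < m then F i (\<lambda>j. e (Suc j)) else e (i - m)))
      = (\<lambda>e. ?P (e 0) (\<lambda>i. e (Suc i)))"
    by (intro ext arg_cong[of _ _ P]) (auto simp: Suc_diff_Suc)
  finally have "Sig (\<lambda>e. ?P (F m e) e)"
    using Suc.prems(2) by (intro Sig_subst1[of ?P]) auto
  also have "(\<lambda>e. ?P (F m e) e) = (\<lambda>e. P (\<lambda>i. if i < Suc m then F i e else e (i - Suc m)))"
    by (intro ext arg_cong[of _ _ P]) (auto simp: less_Suc_eq)
  finally show ?case .
qed

section \<open>Separation of disjoint \<open>\<Sigma>\<^sub>1\<close> predicates\<close>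

lemma subst_msub_skip_tm: "subst_tm k (num n) (msub_tm (Suc (Suc k)) e (ren_tm k (0 \<triangleright> (\<lambda>i. Suc (Suc i))) t))
    = msub_tm k (n \<triangleright> e) t"
proof (induction t)
  case (Var i)
  consider "i < k" | "i = k" | j where "i = Suc (k + j)"
    by (metis less_imp_Suc_add linorder_neqE_nat)
  then show ?case by cases (auto simp: Suc_diff_le)
qed auto

lemma subst_msub_skip: "subst k (num n) (msub (Suc (Suc k)) e (ren k (0 \<triangleright> (\<lambda>i. Suc (Suc i))) \<phi>))
    = msub k (n \<triangleright> e) \<phi>"
  by (induction \<phi> arbitrary: k) (auto simp: subst_msub_skip_tm)

text \<open>The separating formula says that a witness for \<open>P\<close> occurs before any witness for \<open>P'\<close>.\<close>

lemma separation:
  assumes "Sig P" "Sig P'" and disjoint: "\<And>e. \<not> (P e \<and> P' e)"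
  obtains \<phi> where "\<And>e. P e \<Longrightarrow> Q \<turnstile> msub 0 e \<phi>" "\<And>e. P' e \<Longrightarrow> Q \<turnstile> Neg (msub 0 e \<phi>)"
proof -
  obtain R R' where R: "Rep R" "Rep R'" "P = (\<lambda>e. \<exists>b. R (b \<triangleright> e))" "P' = (\<lambda>e. \<exists>b. R' (b \<triangleright> e))"
    using assms(1,2) by (auto elim!: SigE)
  obtain \<psi> where \<psi>: "\<And>e v. pval Q v \<Longrightarrow> v (msub 0 e \<psi>) \<longleftrightarrow> R e"
    using R(1) by (rule RepE) blast
  obtain \<psi>' where \<psi>': "\<And>e v. pval Q v \<Longrightarrow> v (msub 0 e \<psi>') \<longleftrightarrow> R' e"
    "\<And>e. \<not> R' e \<Longrightarrow> Q \<turnstile> Neg (msub 0 e \<psi>')"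
    using R(2) by (rule RepE) blast
  let ?\<chi>' = "ren 0 (0 \<triangleright> (\<lambda>i. Suc (Suc i))) \<psi>'"
  let ?\<theta> = "All (Imp (Le (Var 0) (Var 1)) (Neg ?\<chi>'))"
  let ?\<phi> = "Ex (Conj \<psi> ?\<theta>)"
  have msub: "msub 0 e ?\<phi> = Ex (Conj (msub 1 e \<psi>) (msub 1 e ?\<theta>))" for e
    by (simp add: Ex_def Conj_def)
  show ?thesis
  proof (rule that[of ?\<phi>])
    fix e assume "P e"
    then obtain b where b: "R (b \<triangleright> e)" using R by auto
    \<comment> \<open>By disjointness no number witnesses \<open>P'\<close>, so
      \<open>?\<theta>\<close> holds up to any numeral.\<close>
    have nR': "\<not> R' (x \<triangleright> e)" for x using disjoint[of e] \<open>P e\<close> R by auto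
    have "Q \<turnstile> All (Imp (Le (Var 0) (num b)) (msub 1 (b \<triangleright> e) (Neg ?\<chi>')))"
    proof (rule Q_bounded_All)
      show "fv (msub 1 (b \<triangleright> e) (Neg ?\<chi>')) \<subseteq> {0}" using fv_msub[of 1 "b \<triangleright> e" "Neg ?\<chi>'"] by auto
      fix n
      have "(\<lambda>i. (n \<triangleright> b \<triangleright> e) ((0 \<triangleright> (\<lambda>i. Suc (Suc i))) i)) = n \<triangleright> e"
        by (simp add: comp_scons)
      then show "Q \<turnstile> subst 0 (num n) (msub 1 (b \<triangleright> e) (Neg ?\<chi>'))"
        using \<psi>'(2)[OF nR'] by (simp add: subst_msub msub_ren)
    qed
    then have \<theta>: "Q \<turnstile> msub 0 (b \<triangleright> e) ?\<theta>" by simp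
    show "Q \<turnstile> msub 0 e ?\<phi>"
    proof (rule pval_complete)
      fix v assume v: "pval Q v"
      have "v (subst 0 (num b) (Conj (msub 1 e \<psi>) (msub 1 e ?\<theta>)))"
        using \<psi>[OF v, of "b \<triangleright> e"] b pval_thm[OF v \<theta>] subst_msub[of 0 b e ?\<theta>] subst_msub[of 0 b e \<psi>]
        by (simp add: Conj_def pval_simps[OF v] del: msub.simps)
      then show "v (msub 0 e ?\<phi>)" unfolding msub by (rule pval_ExI[OF v])
    qed
  next
    fix e assume "P' e"
    then obtain b where b: "R' (b \<triangleright> e)" using R by auto
    have nR: "\<not> R (x \<triangleright> e)" for x using disjoint[of e] \<open>P' e\<close> R by auto
    \<comment> \<open>The supposed witness \<open>Var 0\<close> may be nonstandard, so it is
      compared with the numeral \<open>b\<close>: from \<open>b\<close> on, the witness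
      \<open>b\<close> for \<open>P'\<close> violates \<open>?\<theta>\<close>; below
      \<open>b\<close> it equals a numeral, and no numeral witnesses \<open>P\<close>.\<close>
    have "Q \<turnstile> Neg (Conj (msub 1 e \<psi>) (msub 1 e ?\<theta>))"
    proof (rule pval_complete)
      fix v assume v: "pval Q v"
      have "\<not> v (msub 1 e ?\<theta>)" if "v (Le (num b) (Var 0))"
      proof
        assume "v (msub 1 e ?\<theta>)"
        then have "v (All (Imp (Le (Var 0) (Var 1)) (Neg (msub 2 e ?\<chi>'))))"
          by (simp add: numeral_2_eq_2)
        from pval_inst[OF v this, of "num b"] show False
          using subst_msub_skip[of 0 b e \<psi>'] \<psi>'(1)[OF v, of "b \<triangleright> e"] b that
          by (simp add: pval_simps[OF v] numeral_2_eq_2)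
      qed
      moreover have "\<not> v (msub 1 e \<psi>)" if "v (below b (Var 0))"
      proof -
        obtain i where i: "v (Eq (Var 0) (num i))" using \<open>v (below b (Var 0))\<close> pval_below[OF v] by auto
        have "fv (msub 1 e \<psi>) \<subseteq> {0}" using fv_msub[of 1 e \<psi>] by auto
        from pval_eq_num[OF v i this] show ?thesis
          using subst_msub[of 0 i e \<psi>] \<psi>[OF v, of "i \<triangleright> e"] nR by simp
      qed
      ultimately show "v (Neg (Conj (msub 1 e \<psi>) (msub 1 e ?\<theta>)))"
        using Q_num_Le[OF v, of b "Var 0"] by (auto simp: pval_simps[OF v] simp del: msub.simps)
    qed
    from proves.Gen[OF this] show "Q \<turnstile> Neg (msub 0 e ?\<phi>)"
      unfolding msub unfolding Ex_def
      using pval_thm[of Q _ "All (Neg (Conj (msub 1 e \<psi>) (msub 1 e ?\<theta>)))"]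
      by (intro pval_complete) (simp add: pval_simps del: msub.simps)
  qed
qed

section \<open>Inductive definitions\<close>

text \<open>Two premises are enough for every rule below; a rule with one premise is fed it
  twice.\<close>

inductive gen :: "(nat \<Rightarrow> bool) \<Rightarrow> (nat \<Rightarrow> nat \<Rightarrow> nat \<Rightarrow> bool) \<Rightarrow> nat \<Rightarrow> bool" for A R where
  base: "A y \<Longrightarrow> gen A R y"
| step: "R y p q \<Longrightarrow> gen A R p \<Longrightarrow> gen A R q \<Longrightarrow> gen A R y"

text \<open>Finite sets are coded as in Goedel's beta function: the moduli \<open>1 + (z + 1) d\<close> with \<open>z \<le> N\<close> are
  pairwise coprime when every number from \<open>1\<close> to \<open>N\<close> divides \<open>d\<close>.\<close>

definition coded :: "nat \<Rightarrow> nat \<Rightarrow> nat \<Rightarrow> nat \<Rightarrow> bool" where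
  "coded c d N z \<longleftrightarrow> z \<le> N \<and> Suc (Suc z * d) dvd c"

text \<open>A common divisor divides the difference (y - x) * d of the moduli; being coprime to
  \<open>d\<close>, it divides y - x, hence \<open>d\<close>, and so it is 1.\<close>

lemma coprime_moduli:
  assumes "x < y" "(y - x) dvd d" shows "coprime (Suc (Suc x * d)) (Suc (Suc y * d))"
proof (rule coprimeI)
  fix g assume g: "g dvd Suc (Suc x * d)" "g dvd Suc (Suc y * d)"
  have "coprime d (Suc (Suc x * d))"
    by (metis add.commute coprime_1_right coprime_iff_gcd_eq_1 gcd_add_mult mult.commute plus_1_eq_Suc)
  then have "coprime d g" using g(1) by (metis coprime_divisors dvd_refl)
  have "Suc (Suc y * d) - Suc (Suc x * d) = (y - x) * d"
    by (simp add: diff_mult_distrib)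
  then have "g dvd (y - x) * d" using dvd_diff_nat[OF g(2,1)] by metis
  then have "g dvd y - x"
    using \<open>coprime d g\<close> by (simp add: coprime_commute coprime_dvd_mult_left_iff)
  then have "g dvd d" using assms(2) dvd_trans by blast
  then show "g dvd 1" using \<open>coprime d g\<close> by (metis coprime_common_divisor dvd_refl)
qed

text \<open>Only membership is stored, so \<open>c\<close> is the product of the moduli of the
  members. The modulus of a nonmember is coprime to it and greater than 1, since \<open>d\<close> is
  positive.\<close>

lemma finite_set_coded:
  assumes "X \<subseteq> {..N}" obtains c d where "\<And>z. coded c d N z \<longleftrightarrow> z \<in> X"
proof -
  define d where "d = \<Prod>{1..Suc N}"
  let ?m = "\<lambda>z. Suc (Suc z * d)"
  have "d > 0" unfolding d_def by (simp add: prod_pos)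
  have dvd: "y - x dvd d" if "x < y" "y \<le> N" for x y
    unfolding d_def by (rule dvd_prodI[of _ _ "\<lambda>x. x", simplified]) (use that in auto)
  have cop: "coprime (?m x) (?m y)" if "x \<noteq> y" "x \<le> N" "y \<le> N" for x y
    using coprime_moduli dvd that by (metis coprime_commute linorder_neqE_nat)
  show ?thesis
  proof (rule that[of "\<Prod>z\<in>X. ?m z" d])
    fix z
    have fin: "finite X" using assms finite_subset by blast
    show "coded (\<Prod>z\<in>X. ?m z) d N z \<longleftrightarrow> z \<in> X"
    proof
      assume z: "coded (\<Prod>z\<in>X. ?m z) d N z"
      show "z \<in> X"
      proof (rule ccontr)
        assume "z \<notin> X"
        then have "coprime (?m z) (\<Prod>z\<in>X. ?m z)"
          using z assms by (intro prod_coprime_right cop) (auto simp: coded_def)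
        then have "?m z dvd 1" using z by (metis coded_def coprime_common_divisor dvd_refl)
        then show False using \<open>d > 0\<close> by simp
      qed
    next
      assume "z \<in> X"
      then show "coded (\<Prod>z\<in>X. ?m z) d N z"
        unfolding coded_def using fin assms by (auto intro: dvd_prodI)
    qed
  qed
qed

text \<open>A derivation is a finite set of pairs of a rank and a derived number.\<close>

definition justified :: "(nat \<Rightarrow> bool) \<Rightarrow> (nat \<Rightarrow> nat \<Rightarrow> nat \<Rightarrow> bool) \<Rightarrow> (nat \<Rightarrow> bool) \<Rightarrow> nat \<Rightarrow> bool" where
  "justified A R D z \<longleftrightarrow> (\<exists>r y. z = prod_encode (r, y) \<and> (A y \<or> (\<exists>p q r1 r2. R y p q \<and> r1 < r \<and> r2 < r \<and>
     D (prod_encode (r1, p)) \<and> D (prod_encode (r2, q)))))"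

lemma justified_mono: "justified A R D z \<Longrightarrow> (\<And>z. D z \<Longrightarrow> D' z) \<Longrightarrow> justified A R D' z"
  unfolding justified_def by blast

text \<open>Being justified is monotone in the derivation, so derivations can be united; the new
  number gets a rank above those of its premises.\<close>

lemma gen_derivation:
  "gen A R y \<Longrightarrow> \<exists>X r. finite X \<and> prod_encode (r, y) \<in> X \<and> (\<forall>z\<in>X. justified A R (\<lambda>z. z \<in> X) z)"
proof (induction rule: gen.induct)
  case (base y)
  then show ?case
    by (intro exI[of _ "{prod_encode (0, y)}"] exI[of _ 0]) (auto simp: justified_def)
next
  case (step y p q)
  obtain X r1 where X: "finite X" "prod_encode (r1, p) \<in> X" "\<forall>z\<in>X. justified A R (\<lambda>z. z \<in> X) z"
    using step by blast
  obtain Y r2 where Y: "finite Y" "prod_encode (r2, q) \<in> Y" "\<forall>z\<in>Y. justified A R (\<lambda>z. z \<in> Y) z"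
    using step by blast
  let ?r = "Suc (max r1 r2)"
  let ?Z = "insert (prod_encode (?r, y)) (X \<union> Y)"
  have "justified A R (\<lambda>z. z \<in> ?Z) z" if "z \<in> X \<union> Y" for z
    using that X(3) Y(3) justified_mono[of A R _ z "\<lambda>z. z \<in> ?Z"] by blast
  moreover have "justified A R (\<lambda>z. z \<in> ?Z) (prod_encode (?r, y))"
  proof -
    have "r1 < ?r" "r2 < ?r" "prod_encode (r1, p) \<in> ?Z" "prod_encode (r2, q) \<in> ?Z" using X Y by auto
    then show ?thesis unfolding justified_def using step(1) by blast
  qed
  ultimately have "finite ?Z \<and> prod_encode (?r, y) \<in> ?Z \<and> (\<forall>z\<in>?Z. justified A R (\<lambda>z. z \<in> ?Z) z)"
    using X(1) Y(1) by blast
  then show ?case by blast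
qed

text \<open>The ranks exclude circular derivations, in which numbers justify one another; the
  induction runs on them.\<close>

lemma derivation_gen:
  assumes "\<And>z. D z \<Longrightarrow> justified A R D z"
  shows "D (prod_encode (r, y)) \<Longrightarrow> gen A R y"
proof (induction r arbitrary: y rule: less_induct)
  case (less r)
  have "A y \<or> (\<exists>p q r1 r2. R y p q \<and> r1 < r \<and> r2 < r \<and>
     D (prod_encode (r1, p)) \<and> D (prod_encode (r2, q)))"
    using assms[OF less(2)] unfolding justified_def by auto
  then show ?case using less(1) gen.base[of A y R] gen.step[of R y _ _ A] by blast
qed

text \<open>All unbounded quantifiers are existential; the universal one is bounded by
  \<open>N\<close>, which is why \<open>coded\<close> includes this bound. The implication is
  written as a disjunction whose negated part is decidable.\<close>

lemma gen_iff:
  "gen A R y \<longleftrightarrow> (\<exists>c d N r. coded c d N (prod_encode (r, y)) \<and>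
     (\<forall>z\<le>N. \<not> coded c d N z \<or> justified A R (coded c d N) z))"
proof
  assume "gen A R y"
  then obtain X r where X: "finite X" "prod_encode (r, y) \<in> X" "\<forall>z\<in>X. justified A R (\<lambda>z. z \<in> X) z"
    using gen_derivation[OF \<open>gen A R y\<close>] by (elim exE conjE) (rule that)
  have "X \<subseteq> {..Max X}" using X(1) by auto
  then obtain c d where cd: "coded c d (Max X) z \<longleftrightarrow> z \<in> X" for z using finite_set_coded by blast
  have "coded c d (Max X) = (\<lambda>z. z \<in> X)" using cd by blast
  then show "\<exists>c d N r. coded c d N (prod_encode (r, y)) \<and>
     (\<forall>z\<le>N. \<not> coded c d N z \<or> justified A R (coded c d N) z)"
    using X(2,3) by metis
next
  assume "\<exists>c d N r. coded c d N (prod_encode (r, y)) \<and>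
     (\<forall>z\<le>N. \<not> coded c d N z \<or> justified A R (coded c d N) z)"
  then obtain c d N r where "coded c d N (prod_encode (r, y))"
    "\<forall>z\<le>N. \<not> coded c d N z \<or> justified A R (coded c d N) z" by blast
  then show "gen A R y" using derivation_gen[of "coded c d N"] unfolding coded_def by blast
qed

text \<open>The quotient of a division by a positive number is bounded by the dividend.\<close>

lemma Rep_coded: "Rep (\<lambda>e. coded (e c) (e d) (e N) (e z))"
proof -
  have "Suc m dvd n \<longleftrightarrow> (\<exists>q\<le>n. n = q * Suc m)" for m n
    by (metis dvd_def le_add1 mult.commute mult_Suc)
  moreover have "Rep (\<lambda>e. e z \<le> e N \<and> (\<exists>q\<le>e c. e c = q * Suc (Suc (e z) * e d)))"
    using Rep_conj[OF Rep_le[of "Var z" "Var N"] Rep_bex[of "\<lambda>q e. e c = q * Suc (Suc (e z) * e d)" c]]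
      Rep_eq[of "Var (Suc c)" "Mul (Var 0) (Succ (Mul (Succ (Var (Suc z))) (Var (Suc d))))"]
    by simp
  ultimately show ?thesis unfolding coded_def by presburger
qed

lemma Sig_coded:
  assumes "Fn f" shows "Sig (\<lambda>e. coded (e c) (e d) (e N) (f e))"
  by (rule Sig_subst1[where P = "\<lambda>x e. coded (e c) (e d) (e N) x", OF Sig_Rep[OF Rep_coded] assms])

lemma Sig_gen:
  assumes A: "Sig (\<lambda>e. A (\<lambda>i. e (Suc i)) (e 0))"
    and R: "Sig (\<lambda>e. R (\<lambda>i. e (Suc (Suc (Suc i)))) (e 0) (e 1) (e 2))"
    and f: "Fn f"
  shows "Sig (\<lambda>e. gen (A e) (R e) (f e))"
proof (rule Sig_subst1[OF _ f])
  \<comment> \<open>The hypotheses are moved to arbitrary variable positions, for use below the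
    quantifiers that the unfolding brings in.\<close>
  have A': "Sig (\<lambda>e. A (\<lambda>i. e (r i)) (e j))" for r j
    using Sig_ren[OF A, of "j \<triangleright> r"] by simp
  have R': "Sig (\<lambda>e. R (\<lambda>i. e (r i)) (e j) (e k) (e l))" for r j k l
    using Sig_ren[OF R, of "j \<triangleright> k \<triangleright> l \<triangleright> r"] by (simp add: numeral_2_eq_2)
  show "Sig (\<lambda>e. gen (A (\<lambda>i. e (Suc i))) (R (\<lambda>i. e (Suc i))) (e 0))"
    unfolding gen_iff justified_def
    by (intro Sig_intros A' R' Sig_coded Sig_Rep[OF Rep_not[OF Rep_coded]])
qed

section \<open>Recursive functions are \<open>\<Sigma>\<^sub>1\<close>\<close>

text \<open>A computation by recursion is a derivation: each pair of an argument and its value is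
  generated from the preceding pair.\<close>

lemma Fn_rec:
  assumes G: "Fn G" and H: "Fn (\<lambda>e. H (e 0) (e 1) (\<lambda>i. e (Suc (Suc i))))" and k: "Fn k"
  shows "Fn (\<lambda>e. rec_nat (G e) (\<lambda>y r. H y r e) (k e))"
proof -
  define A where "A = (\<lambda>e w. w = prod_encode (0, G e))"
  define R where "R = (\<lambda>e w p (q::nat). \<exists>y r. p = prod_encode (y, r) \<and> w = prod_encode (Suc y, H y r e))"
  have "gen (A e) (R e) w \<longleftrightarrow> (\<exists>n. w = prod_encode (n, rec_nat (G e) (\<lambda>y r. H y r e) n))" for e w
  proof
    show "gen (A e) (R e) w \<Longrightarrow> \<exists>n. w = prod_encode (n, rec_nat (G e) (\<lambda>y r. H y r e) n)"
    proof (induction rule: gen.induct)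
      case (base w)
      then show ?case by (intro exI[of _ 0]) (simp add: A_def)
    next
      case (step w p q)
      then obtain n where n: "p = prod_encode (n, rec_nat (G e) (\<lambda>y r. H y r e) n)" by blast
      then show ?case using step(1) by (intro exI[of _ "Suc n"]) (auto simp: R_def)
    qed
  next
    have "gen (A e) (R e) (prod_encode (n, rec_nat (G e) (\<lambda>y r. H y r e) n))" for n
    proof (induction n)
      case 0 show ?case by (rule gen.base) (simp add: A_def)
    next
      case (Suc n) show ?case by (rule gen.step[OF _ Suc Suc]) (auto simp: R_def)
    qed
    then show "\<exists>n. w = prod_encode (n, rec_nat (G e) (\<lambda>y r. H y r e) n) \<Longrightarrow> gen (A e) (R e) w" by blast
  qed
  then have eq: "z = rec_nat (G e) (\<lambda>y r. H y r e) n \<longleftrightarrow> gen (A e) (R e) (prod_encode (n, z))" for e z n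
    by auto
  have G': "Fn (\<lambda>e. G (\<lambda>i. e (r i)))" for r using Fn_ren[OF G] .
  have k': "Fn (\<lambda>e. k (\<lambda>i. e (r i)))" for r using Fn_ren[OF k] .
  have H': "Fn (\<lambda>e. H (e j) (e l) (\<lambda>i. e (r i)))" for r j l
    using Fn_ren[OF H, of "j \<triangleright> l \<triangleright> r"] by simp
  have "Sig (\<lambda>e. gen (A (\<lambda>i. e (Suc i))) (R (\<lambda>i. e (Suc i))) (prod_encode (k (\<lambda>i. e (Suc i)), e 0)))"
    unfolding A_def R_def
    by (intro Sig_gen Sig_intros G' k' H')
  then show ?thesis unfolding Fn_def eq .
qed

text \<open>Minimality is a bounded statement about nonzero values, which \<open>Sig_neq\<close>
  covers. The disjunct y = z exempts the endpoint of the bounded quantifier.\<close>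

lemma Fn_Least:
  assumes f: "Fn (\<lambda>e. f (e 0) (\<lambda>i. e (Suc i)))" and ex: "\<And>e. \<exists>y. f y e = 0"
  shows "Fn (\<lambda>e. LEAST y. f y e = 0)"
proof -
  have eq: "z = (LEAST y. f y e = 0) \<longleftrightarrow> f z e = 0 \<and> (\<forall>y\<le>z. y = z \<or> f y e \<noteq> 0)" for z e
  proof
    assume z: "z = (LEAST y. f y e = 0)"
    then show "f z e = 0 \<and> (\<forall>y\<le>z. y = z \<or> f y e \<noteq> 0)"
      using LeastI_ex[OF ex[of e]] not_less_Least[of _ "\<lambda>y. f y e = 0"] by (metis le_neq_implies_less)
  next
    assume z: "f z e = 0 \<and> (\<forall>y\<le>z. y = z \<or> f y e \<noteq> 0)"
    then show "z = (LEAST y. f y e = 0)"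
      by (intro Least_equality[symmetric]) (auto, metis nat_le_linear neq0_conv)
  qed
  have f': "Fn (\<lambda>e. f (e j) (\<lambda>i. e (r i)))" for j r
    using Fn_ren[OF f, of "j \<triangleright> r"] by simp
  show ?thesis unfolding Fn_def eq by (intro Sig_intros f')
qed

lemma map_upt_Suc: "map e [0..<Suc n] = e 0 # map (\<lambda>i. e (Suc i)) [0..<n]"
  by (simp add: map_upt_Suc del: upt_Suc)

lemma Fn_comp:
  assumes G: "Fn (\<lambda>e. g (map e [0..<length hs]))"
    and H: "\<And>h. h \<in> set hs \<Longrightarrow> Fn (\<lambda>e. h (map e [0..<n]))"
  shows "Fn (\<lambda>e. g (map (\<lambda>h. h (map e [0..<n])) hs))"
proof -
  \<comment> \<open>Slot 0 is kept for the value in the graph of \<open>g\<close>; the inner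
    functions fill the slots from 1 on.\<close>
  define F where "F = (\<lambda>i e. if i = 0 then e 0 else (hs ! (i - 1)) (map (\<lambda>j. e (Suc j)) [0..<n]))"
  let ?P = "\<lambda>e. e 0 = g (map (\<lambda>i. e (Suc i)) [0..<length hs])"
  have "Fn (F i)" if "i < Suc (length hs)" for i
  proof (cases i)
    case 0 then show ?thesis unfolding F_def using Fn_var by simp
  next
    case (Suc j)
    then show ?thesis using Fn_ren[OF H[of "hs ! j"], of Suc] that by (simp add: F_def)
  qed
  then have "Sig (\<lambda>e. ?P (\<lambda>i. if i < Suc (length hs) then F i e else e (i - Suc (length hs))))"
    by (rule Sig_subst[OF G[unfolded Fn_def]])
  moreover have "map (\<lambda>i. if Suc i < Suc (length hs) then F (Suc i) e else e' i) [0..<length hs]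
      = map (\<lambda>h. h (map (\<lambda>i. e (Suc i)) [0..<n])) hs" for e e'
    by (rule nth_equalityI) (simp_all add: F_def)
  ultimately show ?thesis by (simp add: Fn_def F_def cong: map_cong)
qed

lemma recursive_fn_Fn: "recursive_fn n f \<Longrightarrow> Fn (\<lambda>e. f (map e [0..<n]))"
proof (induction rule: recursive_fn.induct)
  case (zero n)
  show ?case by (rule Fn_const)
next
  case succ
  show ?case using Fn_Suc[OF Fn_var[of 0]] by simp
next
  case (proj i n)
  then show ?case using Fn_var[of i] by simp
next
  case (comp hs g n)
  then show ?case by (intro Fn_comp) auto
next
  case (prim_rec n g h)
  have "Fn (\<lambda>e. rec_nat (g (map (\<lambda>i. e (Suc i)) [0..<n]))
      (\<lambda>y r. h (y # r # map (\<lambda>i. e (Suc i)) [0..<n])) (e 0))"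
  proof (rule Fn_rec)
    show "Fn (\<lambda>e. g (map (\<lambda>i. e (Suc i)) [0..<n]))" using Fn_ren[OF prim_rec.IH(1), of Suc] by simp
    show "Fn (\<lambda>e. h (e 0 # e 1 # map (\<lambda>i. e (Suc (Suc (Suc i)))) [0..<n]))"
      using Fn_ren[OF prim_rec.IH(2), of "0 \<triangleright> Suc 0 \<triangleright> (\<lambda>i. Suc (Suc (Suc i)))"]
      by (simp add: map_upt_Suc del: upt_Suc)
  qed (rule Fn_var)
  then show ?case by (simp add: map_upt_Suc del: upt_Suc)
next
  case (minim n f)
  then show ?case
    by (intro Fn_Least[of "\<lambda>y e. f (y # map e [0..<n])"]) (auto simp: map_upt_Suc simp del: upt_Suc)
next
  case (cong n f g)
  then show ?case by simp
qed

lemma recursive_set_Sig: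
  assumes "recursive_set A" shows "Sig (\<lambda>e. e 0 \<in> A)"
proof -
  have "Fn (\<lambda>e. if e 0 \<in> A then 1 else 0)"
    using recursive_fn_Fn[OF assms[unfolded recursive_set_def]] by simp
  from Sig_eq[OF this Fn_const[of 1]] show ?thesis by (simp split: if_splits cong: if_cong)
qed

section \<open>Provability is \<open>\<Sigma>\<^sub>1\<close>\<close>

abbreviation pair :: "nat \<Rightarrow> nat \<Rightarrow> nat" where "pair a b \<equiv> prod_encode (a, b)"

abbreviation cVar :: "nat \<Rightarrow> nat" where "cVar i \<equiv> pair 0 i"
abbreviation cZero :: nat where "cZero \<equiv> pair 1 0"
abbreviation cSucc :: "nat \<Rightarrow> nat" where "cSucc a \<equiv> pair 2 a"
abbreviation cAdd :: "nat \<Rightarrow> nat \<Rightarrow> nat" where "cAdd a b \<equiv> pair 3 (pair a b)"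
abbreviation cMul :: "nat \<Rightarrow> nat \<Rightarrow> nat" where "cMul a b \<equiv> pair 4 (pair a b)"
abbreviation cEq :: "nat \<Rightarrow> nat \<Rightarrow> nat" where "cEq a b \<equiv> pair 0 (pair a b)"
abbreviation cLe :: "nat \<Rightarrow> nat \<Rightarrow> nat" where "cLe a b \<equiv> pair 1 (pair a b)"
abbreviation cNeg :: "nat \<Rightarrow> nat" where "cNeg a \<equiv> pair 2 a"
abbreviation cImp :: "nat \<Rightarrow> nat \<Rightarrow> nat" where "cImp a b \<equiv> pair 3 (pair a b)"
abbreviation cAll :: "nat \<Rightarrow> nat" where "cAll a \<equiv> pair 4 a"

lemma Sig_pred: "Sig (\<lambda>e. S (e 0)) \<Longrightarrow> Fn f \<Longrightarrow> Sig (\<lambda>e. S (f e))"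
  by (rule Sig_subst1[where P = "\<lambda>x e. S x"])

lemma Sig_gen_closed:
  "Sig (\<lambda>e. A (e 0)) \<Longrightarrow> Sig (\<lambda>e. R (e 0) (e 1) (e 2)) \<Longrightarrow> Sig (\<lambda>e. gen A R (e 0))"
  by (rule Sig_gen[where A = "\<lambda>_. A" and R = "\<lambda>_. R", OF _ _ Fn_var])

text \<open>A graph, as a set of coded triples, suits \<open>gen\<close> and fixes no value on
  numbers that are not codes.\<close>

definition lift_tm_graph :: "nat \<Rightarrow> bool" where
  "lift_tm_graph w \<longleftrightarrow> (\<exists>k t. w = pair k (pair (code_tm t) (code_tm (lift_tm k t))))"

lemma Sig_lift_tm_graph: "Fn f \<Longrightarrow> Sig (\<lambda>e. lift_tm_graph (f e))"
proof -
  define A where "A = (\<lambda>w. (\<exists>k i. i < k \<and> w = pair k (pair (cVar i) (cVar i))) \<or>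
    (\<exists>k i. k \<le> i \<and> w = pair k (pair (cVar i) (cVar (Suc i)))) \<or> (\<exists>k. w = pair k (pair cZero cZero)))"
  define R where "R = (\<lambda>w p q. \<exists>k a a' b b'. p = pair k (pair a a') \<and> q = pair k (pair b b') \<and>
    (w = pair k (pair (cSucc a) (cSucc a')) \<or> w = pair k (pair (cAdd a b) (cAdd a' b')) \<or>
     w = pair k (pair (cMul a b) (cMul a' b'))))"
  have "lift_tm_graph = gen A R"
  proof (rule ext, rule iffI)
    fix w
    have "gen A R (pair k (pair (code_tm t) (code_tm (lift_tm k t))))" for k t
    proof (induction t)
      case (Var i) show ?case by (rule gen.base) (auto simp: A_def)
    next
      case Zero show ?case by (rule gen.base) (auto simp: A_def)
    next
      case (Succ t) show ?case by (rule gen.step[OF _ Succ Succ]) (auto simp: R_def)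
    next
      case (Add s t) show ?case by (rule gen.step[OF _ Add]) (auto simp: R_def)
    next
      case (Mul s t) show ?case by (rule gen.step[OF _ Mul]) (auto simp: R_def)
    qed
    then show "lift_tm_graph w \<Longrightarrow> gen A R w" unfolding lift_tm_graph_def by blast
    show "gen A R w \<Longrightarrow> lift_tm_graph w"
    proof (induction rule: gen.induct)
      case (base w)
      then consider k i where "i < k" "w = pair k (pair (cVar i) (cVar i))"
        | k i where "k \<le> i" "w = pair k (pair (cVar i) (cVar (Suc i)))" | k where "w = pair k (pair cZero cZero)"
        unfolding A_def by blast
      then show ?case unfolding lift_tm_graph_def
      proof cases
        case (1 k i) then show "\<exists>k t. w = pair k (pair (code_tm t) (code_tm (lift_tm k t)))"
          by (intro exI[of _ k] exI[of _ "Var i"]) auto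
      next
        case (2 k i) then show "\<exists>k t. w = pair k (pair (code_tm t) (code_tm (lift_tm k t)))"
          by (intro exI[of _ k] exI[of _ "Var i"]) auto
      next
        case (3 k) then show "\<exists>k t. w = pair k (pair (code_tm t) (code_tm (lift_tm k t)))"
          by (intro exI[of _ k] exI[of _ Zero]) auto
      qed
    next
      case (step w p q)
      then obtain k s t where
        "w = pair k (pair (cSucc (code_tm s)) (cSucc (code_tm (lift_tm k s)))) \<or>
         w = pair k (pair (cAdd (code_tm s) (code_tm t)) (cAdd (code_tm (lift_tm k s)) (code_tm (lift_tm k t)))) \<or>
         w = pair k (pair (cMul (code_tm s) (code_tm t)) (cMul (code_tm (lift_tm k s)) (code_tm (lift_tm k t))))"
        unfolding R_def lift_tm_graph_def by force
      then show ?case unfolding lift_tm_graph_def by (metis code_tm.simps(3-5) lift_tm.simps(3-5))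
    qed
  qed
  moreover have "Sig (\<lambda>e. gen A R (e 0))"
    unfolding A_def R_def by (intro Sig_gen_closed Sig_intros)
  ultimately show "Fn f \<Longrightarrow> Sig (\<lambda>e. lift_tm_graph (f e))" using Sig_pred[of lift_tm_graph] by simp
qed

definition is_tm :: "nat \<Rightarrow> bool" where "is_tm a \<longleftrightarrow> (\<exists>t. a = code_tm t)"

text \<open>Lifting is total on terms, so their codes are the arguments occurring in its
  graph.\<close>

lemma Sig_is_tm: "Fn f \<Longrightarrow> Sig (\<lambda>e. is_tm (f e))"
proof -
  have "is_tm a \<longleftrightarrow> (\<exists>b. lift_tm_graph (pair 0 (pair a b)))" for a
    by (auto simp: is_tm_def lift_tm_graph_def)
  moreover have "Sig (\<lambda>e. \<exists>b. lift_tm_graph (pair 0 (pair (e 0) b)))"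
    by (intro Sig_intros Sig_lift_tm_graph)
  ultimately show "Fn f \<Longrightarrow> Sig (\<lambda>e. is_tm (f e))" using Sig_pred[of is_tm] by simp
qed

definition subst_tm_graph :: "nat \<Rightarrow> bool" where
  "subst_tm_graph w \<longleftrightarrow> (\<exists>k u t. w = pair k (pair (code_tm u) (pair (code_tm t) (code_tm (subst_tm k u t)))))"

lemma Sig_subst_tm_graph: "Fn f \<Longrightarrow> Sig (\<lambda>e. subst_tm_graph (f e))"
proof -
  \<comment> \<open>An index above \<open>k\<close> is written as a successor, so that lowering it
    takes no predecessor function.\<close>
  define A where "A = (\<lambda>w. \<exists>k u. is_tm u \<and> ((\<exists>i. i < k \<and> w = pair k (pair u (pair (cVar i) (cVar i)))) \<or>
    w = pair k (pair u (pair (cVar k) u)) \<or>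
    (\<exists>i. k \<le> i \<and> w = pair k (pair u (pair (cVar (Suc i)) (cVar i)))) \<or> w = pair k (pair u (pair cZero cZero))))"
  define R where "R = (\<lambda>w p q. \<exists>k u a a' b b'. p = pair k (pair u (pair a a')) \<and> q = pair k (pair u (pair b b')) \<and>
    (w = pair k (pair u (pair (cSucc a) (cSucc a'))) \<or> w = pair k (pair u (pair (cAdd a b) (cAdd a' b'))) \<or>
     w = pair k (pair u (pair (cMul a b) (cMul a' b')))))"
  have "subst_tm_graph = gen A R"
  proof (rule ext, rule iffI)
    fix w
    have "gen A R (pair k (pair (code_tm u) (pair (code_tm t) (code_tm (subst_tm k u t)))))" for k u t
    proof (induction t)
      case (Var i)
      consider "i < k" | "i = k" | j where "i = Suc j" "k \<le> j"
        by (metis Suc_le_D less_Suc_eq_le not_less_eq linorder_neqE_nat Suc_leI)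
      then show ?case by cases (rule gen.base, force simp: A_def is_tm_def)+
    next
      case Zero show ?case by (rule gen.base) (auto simp: A_def is_tm_def)
    next
      case (Succ t) show ?case by (rule gen.step[OF _ Succ Succ]) (auto simp: R_def)
    next
      case (Add s t) show ?case by (rule gen.step[OF _ Add]) (auto simp: R_def)
    next
      case (Mul s t) show ?case by (rule gen.step[OF _ Mul]) (auto simp: R_def)
    qed
    then show "subst_tm_graph w \<Longrightarrow> gen A R w" unfolding subst_tm_graph_def by blast
    show "gen A R w \<Longrightarrow> subst_tm_graph w"
    proof (induction rule: gen.induct)
      case (base w)
      then obtain k u where "(\<exists>i. i < k \<and> w = pair k (pair (code_tm u) (pair (cVar i) (cVar i)))) \<or>
         w = pair k (pair (code_tm u) (pair (cVar k) (code_tm u))) \<or>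
         (\<exists>i. k \<le> i \<and> w = pair k (pair (code_tm u) (pair (cVar (Suc i)) (cVar i)))) \<or>
         w = pair k (pair (code_tm u) (pair cZero cZero))"
        unfolding A_def is_tm_def by blast
      then have "\<exists>t. w = pair k (pair (code_tm u) (pair (code_tm t) (code_tm (subst_tm k u t))))"
      proof (elim disjE exE conjE)
        fix i assume "i < k" "w = pair k (pair (code_tm u) (pair (cVar i) (cVar i)))"
        then show ?thesis by (intro exI[of _ "Var i"]) auto
      next
        assume "w = pair k (pair (code_tm u) (pair (cVar k) (code_tm u)))"
        then show ?thesis by (intro exI[of _ "Var k"]) auto
      next
        fix i assume "k \<le> i" "w = pair k (pair (code_tm u) (pair (cVar (Suc i)) (cVar i)))"
        then show ?thesis by (intro exI[of _ "Var (Suc i)"]) auto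
      next
        assume "w = pair k (pair (code_tm u) (pair cZero cZero))"
        then show ?thesis by (intro exI[of _ Zero]) auto
      qed
      then show ?case unfolding subst_tm_graph_def by blast
    next
      case (step w p q)
      \<comment> \<open>Both premises contain the same number for the substituted term;
        \<open>code_tm_inject\<close> identifies the two terms.\<close>
      then obtain k u s t where
        "w = pair k (pair (code_tm u) (pair (cSucc (code_tm s)) (cSucc (code_tm (subst_tm k u s))))) \<or>
         w = pair k (pair (code_tm u) (pair (cAdd (code_tm s) (code_tm t))
           (cAdd (code_tm (subst_tm k u s)) (code_tm (subst_tm k u t))))) \<or>
         w = pair k (pair (code_tm u) (pair (cMul (code_tm s) (code_tm t))
           (cMul (code_tm (subst_tm k u s)) (code_tm (subst_tm k u t)))))"
        unfolding R_def subst_tm_graph_def by (force simp: code_tm_inject)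
      then show ?case unfolding subst_tm_graph_def by (metis code_tm.simps(3-5) subst_tm.simps(3-5))
    qed
  qed
  moreover have "Sig (\<lambda>e. gen A R (e 0))"
    unfolding A_def R_def by (intro Sig_gen_closed Sig_intros Sig_is_tm)
  ultimately show "Fn f \<Longrightarrow> Sig (\<lambda>e. subst_tm_graph (f e))" using Sig_pred[of subst_tm_graph] by simp
qed

definition lift_graph :: "nat \<Rightarrow> bool" where
  "lift_graph w \<longleftrightarrow> (\<exists>k \<phi>. w = pair k (pair (code_fm \<phi>) (code_fm (lift k \<phi>))))"

lemma Sig_lift_graph: "Fn f \<Longrightarrow> Sig (\<lambda>e. lift_graph (f e))"
proof -
  define A where "A = (\<lambda>w. \<exists>k a a' b b'. lift_tm_graph (pair k (pair a a')) \<and> lift_tm_graph (pair k (pair b b')) \<and>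
    (w = pair k (pair (cEq a b) (cEq a' b')) \<or> w = pair k (pair (cLe a b) (cLe a' b'))))"
  define R where "R = (\<lambda>w p q. \<exists>k a a' b b'.
    p = pair k (pair a a') \<and> q = pair k (pair b b') \<and> w = pair k (pair (cNeg a) (cNeg a')) \<or>
    p = pair k (pair a a') \<and> q = pair k (pair b b') \<and> w = pair k (pair (cImp a b) (cImp a' b')) \<or>
    p = pair (Suc k) (pair a a') \<and> w = pair k (pair (cAll a) (cAll a')))"
  have "lift_graph = gen A R"
  proof (rule ext, rule iffI)
    fix w
    have "gen A R (pair k (pair (code_fm \<phi>) (code_fm (lift k \<phi>))))" for k \<phi>
    proof (induction \<phi> arbitrary: k)
      case (Eq s t) show ?case by (rule gen.base) (auto simp: A_def lift_tm_graph_def)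
    next
      case (Le s t) show ?case by (rule gen.base) (auto simp: A_def lift_tm_graph_def)
    next
      case (Neg \<phi>) show ?case by (rule gen.step[OF _ Neg Neg]) (auto simp: R_def)
    next
      case (Imp \<phi> \<psi>) show ?case by (rule gen.step[OF _ Imp]) (auto simp: R_def)
    next
      case (All \<phi>) show ?case by (rule gen.step[OF _ All All]) (auto simp: R_def)
    qed
    then show "lift_graph w \<Longrightarrow> gen A R w" unfolding lift_graph_def by blast
    show "gen A R w \<Longrightarrow> lift_graph w"
    proof (induction rule: gen.induct)
      case (base w)
      then obtain k s t where
        "w = pair k (pair (cEq (code_tm s) (code_tm t)) (cEq (code_tm (lift_tm k s)) (code_tm (lift_tm k t)))) \<or>
         w = pair k (pair (cLe (code_tm s) (code_tm t)) (cLe (code_tm (lift_tm k s)) (code_tm (lift_tm k t))))"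
        unfolding A_def lift_tm_graph_def by force
      then show ?case unfolding lift_graph_def by (metis code_fm.simps(1,2) lift.simps(1,2))
    next
      case (step w p q)
      then obtain k \<phi> \<psi> where
        "w = pair k (pair (cNeg (code_fm \<phi>)) (cNeg (code_fm (lift k \<phi>)))) \<or>
         w = pair k (pair (cImp (code_fm \<phi>) (code_fm \<psi>)) (cImp (code_fm (lift k \<phi>)) (code_fm (lift k \<psi>)))) \<or>
         w = pair k (pair (cAll (code_fm \<phi>)) (cAll (code_fm (lift (Suc k) \<phi>))))"
        unfolding R_def lift_graph_def by force
      then show ?case unfolding lift_graph_def by (metis code_fm.simps(3-5) lift.simps(3-5))
    qed
  qed
  moreover have "Sig (\<lambda>e. gen A R (e 0))"
    unfolding A_def R_def by (intro Sig_gen_closed Sig_intros Sig_lift_tm_graph)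
  ultimately show "Fn f \<Longrightarrow> Sig (\<lambda>e. lift_graph (f e))" using Sig_pred[of lift_graph] by simp
qed

definition is_fm :: "nat \<Rightarrow> bool" where "is_fm a \<longleftrightarrow> (\<exists>\<phi>. a = code_fm \<phi>)"

lemma Sig_is_fm: "Fn f \<Longrightarrow> Sig (\<lambda>e. is_fm (f e))"
proof -
  have "is_fm a \<longleftrightarrow> (\<exists>b. lift_graph (pair 0 (pair a b)))" for a
    by (auto simp: is_fm_def lift_graph_def)
  moreover have "Sig (\<lambda>e. \<exists>b. lift_graph (pair 0 (pair (e 0) b)))"
    by (intro Sig_intros Sig_lift_graph)
  ultimately show "Fn f \<Longrightarrow> Sig (\<lambda>e. is_fm (f e))" using Sig_pred[of is_fm] by simp
qed

text \<open>Index and term belong to the tuple instead of being parameters of \<open>gen\<close>,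
  since below a quantifier the index is raised and the term lifted.\<close>

definition subst_graph :: "nat \<Rightarrow> bool" where
  "subst_graph w \<longleftrightarrow> (\<exists>k u \<phi>. w = pair k (pair (code_tm u) (pair (code_fm \<phi>) (code_fm (subst k u \<phi>)))))"

lemma Sig_subst_graph: "Fn f \<Longrightarrow> Sig (\<lambda>e. subst_graph (f e))"
proof -
  define A where "A = (\<lambda>w. \<exists>k u a a' b b'. subst_tm_graph (pair k (pair u (pair a a'))) \<and>
    subst_tm_graph (pair k (pair u (pair b b'))) \<and>
    (w = pair k (pair u (pair (cEq a b) (cEq a' b'))) \<or> w = pair k (pair u (pair (cLe a b) (cLe a' b')))))"
  define R where "R = (\<lambda>w p q. \<exists>k u u' a a' b b'.
    p = pair k (pair u (pair a a')) \<and> q = pair k (pair u (pair b b')) \<and> w = pair k (pair u (pair (cNeg a) (cNeg a'))) \<or>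
    p = pair k (pair u (pair a a')) \<and> q = pair k (pair u (pair b b')) \<and>
      w = pair k (pair u (pair (cImp a b) (cImp a' b'))) \<or>
    p = pair (Suc k) (pair u' (pair a a')) \<and> lift_tm_graph (pair 0 (pair u u')) \<and>
      w = pair k (pair u (pair (cAll a) (cAll a'))))"
  have "subst_graph = gen A R"
  proof (rule ext, rule iffI)
    fix w
    have "gen A R (pair k (pair (code_tm u) (pair (code_fm \<phi>) (code_fm (subst k u \<phi>)))))" for k u \<phi>
    proof (induction \<phi> arbitrary: k u)
      case (Eq s t) show ?case by (rule gen.base) (auto simp: A_def subst_tm_graph_def code_tm_inject)
    next
      case (Le s t) show ?case by (rule gen.base) (auto simp: A_def subst_tm_graph_def code_tm_inject)
    next
      case (Neg \<phi>) show ?case by (rule gen.step[OF _ Neg Neg]) (auto simp: R_def)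
    next
      case (Imp \<phi> \<psi>) show ?case by (rule gen.step[OF _ Imp]) (auto simp: R_def)
    next
      case (All \<phi>) show ?case by (rule gen.step[OF _ All All]) (auto simp: R_def lift_tm_graph_def)
    qed
    then show "subst_graph w \<Longrightarrow> gen A R w" unfolding subst_graph_def by blast
    show "gen A R w \<Longrightarrow> subst_graph w"
    proof (induction rule: gen.induct)
      case (base w)
      then obtain k u s t where
        "w = pair k (pair (code_tm u) (pair (cEq (code_tm s) (code_tm t))
           (cEq (code_tm (subst_tm k u s)) (code_tm (subst_tm k u t))))) \<or>
         w = pair k (pair (code_tm u) (pair (cLe (code_tm s) (code_tm t))
           (cLe (code_tm (subst_tm k u s)) (code_tm (subst_tm k u t)))))"
        unfolding A_def subst_tm_graph_def by (force simp: code_tm_inject)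
      then show ?case unfolding subst_graph_def by (metis code_fm.simps(1,2) subst.simps(1,2))
    next
      case (step w p q)
      then obtain k u \<phi> \<psi> where
        "w = pair k (pair (code_tm u) (pair (cNeg (code_fm \<phi>)) (cNeg (code_fm (subst k u \<phi>))))) \<or>
         w = pair k (pair (code_tm u) (pair (cImp (code_fm \<phi>) (code_fm \<psi>))
           (cImp (code_fm (subst k u \<phi>)) (code_fm (subst k u \<psi>))))) \<or>
         w = pair k (pair (code_tm u) (pair (cAll (code_fm \<phi>)) (cAll (code_fm (subst (Suc k) (lift_tm 0 u) \<phi>)))))"
        unfolding R_def subst_graph_def lift_tm_graph_def by (force simp: code_tm_inject)
      then show ?case unfolding subst_graph_def by (metis code_fm.simps(3-5) subst.simps(3-5))
    qed
  qed
  moreover have "Sig (\<lambda>e. gen A R (e 0))"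
    unfolding A_def R_def by (intro Sig_gen_closed Sig_intros Sig_subst_tm_graph Sig_lift_tm_graph)
  ultimately show "Fn f \<Longrightarrow> Sig (\<lambda>e. subst_graph (f e))" using Sig_pred[of subst_graph] by simp
qed

definition theorem_code :: "fm set \<Rightarrow> nat \<Rightarrow> bool" where
  "theorem_code T w \<longleftrightarrow> (\<exists>\<phi>. w = code_fm \<phi> \<and> T \<turnstile> \<phi>)"

lemma theorem_code_iff: "theorem_code T (code_fm \<phi>) \<longleftrightarrow> T \<turnstile> \<phi>"
  by (auto simp: theorem_code_def code_fm_inject)

text \<open>Each axiom scheme is a \<open>\<Sigma>\<^sub>1\<close> condition on codes; modus ponens
  and generalization are the generating rules. In the Leibniz scheme the shared \<open>a\<close>
  ties both instances to one formula.\<close>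

lemma Sig_theorem_code:
  assumes T: "Sig (\<lambda>e. e 0 \<in> code_fm ` T)" shows "Fn f \<Longrightarrow> Sig (\<lambda>e. theorem_code T (f e))"
proof -
  define A where "A = (\<lambda>w. w \<in> code_fm ` T \<or>
    (\<exists>a b. is_fm a \<and> is_fm b \<and> w = cImp a (cImp b a)) \<or>
    (\<exists>a b c. is_fm a \<and> is_fm b \<and> is_fm c \<and> w = cImp (cImp a (cImp b c)) (cImp (cImp a b) (cImp a c))) \<or>
    (\<exists>a b. is_fm a \<and> is_fm b \<and> w = cImp (cImp (cNeg a) (cNeg b)) (cImp b a)) \<or>
    (\<exists>t a b. subst_graph (pair 0 (pair t (pair a b))) \<and> w = cImp (cAll a) b) \<or>
    (\<exists>a b. is_fm a \<and> is_fm b \<and> w = cImp (cAll (cImp a b)) (cImp (cAll a) (cAll b))) \<or>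
    (\<exists>a b. lift_graph (pair 0 (pair a b)) \<and> w = cImp a (cAll b)) \<or>
    (\<exists>t. is_tm t \<and> w = cEq t t) \<or>
    (\<exists>s t a b c. subst_graph (pair 0 (pair s (pair a b))) \<and> subst_graph (pair 0 (pair t (pair a c))) \<and>
       w = cImp (cEq s t) (cImp b c)))"
  define R where "R = (\<lambda>w p q. p = cImp q w \<or> w = cAll p)"
  have "theorem_code T = gen A R"
  proof (rule ext, rule iffI)
    fix w
    have "T \<turnstile> \<phi> \<Longrightarrow> gen A R (code_fm \<phi>)" for \<phi>
    proof (induction rule: proves.induct)
      case (MP \<phi> \<psi>) show ?case by (rule gen.step[OF _ MP(3,4)]) (simp add: R_def)
    next
      case (Gen \<phi>) show ?case by (rule gen.step[OF _ Gen(2,2)]) (simp add: R_def)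
    next
      case (Ax_Leibniz s t \<phi>)
      have *: "subst_graph (pair 0 (pair (code_tm u) (pair (code_fm \<phi>) (code_fm (subst 0 u \<phi>)))))" for u
        unfolding subst_graph_def by blast
      have "A (code_fm (Imp (Eq s t) (Imp (subst 0 s \<phi>) (subst 0 t \<phi>))))"
        unfolding A_def by (simp only: code_fm.simps) (use *[of s] *[of t] in blast)
      then show ?case by (rule gen.base)
    next
      case (Ax_inst \<phi> t)
      have "subst_graph (pair 0 (pair (code_tm t) (pair (code_fm \<phi>) (code_fm (subst 0 t \<phi>)))))"
        unfolding subst_graph_def by blast
      then have "A (code_fm (Imp (All \<phi>) (subst 0 t \<phi>)))"
        unfolding A_def by (simp only: code_fm.simps) blast
      then show ?case by (rule gen.base)
    next
      case (Ax_vacuous \<phi>)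
      have "lift_graph (pair 0 (pair (code_fm \<phi>) (code_fm (lift 0 \<phi>))))"
        unfolding lift_graph_def by blast
      then have "A (code_fm (Imp \<phi> (All (lift 0 \<phi>))))"
        unfolding A_def by (simp only: code_fm.simps) blast
      then show ?case by (rule gen.base)
    qed (rule gen.base, auto simp: A_def is_fm_def is_tm_def)+
    then show "theorem_code T w \<Longrightarrow> gen A R w" unfolding theorem_code_def by blast
    show "gen A R w \<Longrightarrow> theorem_code T w"
    proof (induction rule: gen.induct)
      case (base w)
      then show ?case
        unfolding A_def
      proof (elim disjE exE conjE)
        assume "w \<in> code_fm ` T"
        then show ?thesis unfolding theorem_code_def using proves.Hyp by blast
      next
        fix a b assume "is_fm a" "is_fm b" "w = cImp a (cImp b a)"
        then show ?thesis unfolding is_fm_def theorem_code_def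
          using proves.Ax_K by (metis code_fm.simps(4))
      next
        fix a b c assume "is_fm a" "is_fm b" "is_fm c"
          "w = cImp (cImp a (cImp b c)) (cImp (cImp a b) (cImp a c))"
        then show ?thesis unfolding is_fm_def theorem_code_def
          using proves.Ax_S by (metis code_fm.simps(4))
      next
        fix a b assume "is_fm a" "is_fm b" "w = cImp (cImp (cNeg a) (cNeg b)) (cImp b a)"
        then show ?thesis unfolding is_fm_def theorem_code_def
          using proves.Ax_contrapos by (metis code_fm.simps(3,4))
      next
        fix t a b assume "subst_graph (pair 0 (pair t (pair a b)))" "w = cImp (cAll a) b"
        then obtain u \<phi> where "w = code_fm (Imp (All \<phi>) (subst 0 u \<phi>))"
          by (auto simp: subst_graph_def)
        then show ?thesis unfolding theorem_code_def using proves.Ax_inst by blast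
      next
        fix a b assume "is_fm a" "is_fm b" "w = cImp (cAll (cImp a b)) (cImp (cAll a) (cAll b))"
        then show ?thesis unfolding is_fm_def theorem_code_def
          using proves.Ax_distrib by (metis code_fm.simps(4,5))
      next
        fix a b assume "lift_graph (pair 0 (pair a b))" "w = cImp a (cAll b)"
        then obtain \<phi> where "w = code_fm (Imp \<phi> (All (lift 0 \<phi>)))"
          by (auto simp: lift_graph_def)
        then show ?thesis unfolding theorem_code_def using proves.Ax_vacuous by blast
      next
        fix t assume "is_tm t" "w = cEq t t"
        then show ?thesis unfolding is_tm_def theorem_code_def
          using proves.Ax_refl by (metis code_fm.simps(1))
      next
        fix s t a b c assume *: "subst_graph (pair 0 (pair s (pair a b)))"
          "subst_graph (pair 0 (pair t (pair a c)))" "w = cImp (cEq s t) (cImp b c)"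
        from *(1) obtain s' \<phi> where s: "s = code_tm s'" "a = code_fm \<phi>" "b = code_fm (subst 0 s' \<phi>)"
          by (auto simp: subst_graph_def)
        moreover from *(2) s(2) obtain t' where "t = code_tm t'" "c = code_fm (subst 0 t' \<phi>)"
          by (auto simp: subst_graph_def code_fm_inject)
        ultimately have "w = code_fm (Imp (Eq s' t') (Imp (subst 0 s' \<phi>) (subst 0 t' \<phi>)))"
          using *(3) by simp
        then show ?thesis unfolding theorem_code_def using proves.Ax_Leibniz by blast
      qed
    next
      case (step w p q)
      then obtain \<phi> \<psi> where *: "p = code_fm \<phi>" "T \<turnstile> \<phi>" "q = code_fm \<psi>" "T \<turnstile> \<psi>"
        unfolding theorem_code_def by blast
      show ?case
      proof (cases "w = cAll p")
        case True
        then have "w = code_fm (All \<phi>)" using * by simp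
        then show ?thesis unfolding theorem_code_def using proves.Gen[OF *(2)] by blast
      next
        case False
        \<comment> \<open>\<open>w\<close> is not assumed to be a code; that it is one is read off
          from the formula coded by \<open>p\<close>.\<close>
        then have "code_fm \<phi> = cImp (code_fm \<psi>) w" using step(1) * by (simp add: R_def)
        then obtain \<chi> where "\<phi> = Imp \<psi> \<chi>" "w = code_fm \<chi>" by (cases \<phi>) (auto simp: code_fm_inject)
        then show ?thesis unfolding theorem_code_def using proves.MP *(2,4) by blast
      qed
    qed
  qed
  moreover have "Sig (\<lambda>e. gen A R (e 0))"
    unfolding A_def R_def
    by (intro Sig_gen_closed Sig_intros T Sig_is_fm Sig_is_tm Sig_lift_graph Sig_subst_graph)
  ultimately show "Fn f \<Longrightarrow> Sig (\<lambda>e. theorem_code T (f e))" using Sig_pred[of "theorem_code T"] by simp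
qed

section \<open>Incompleteness\<close>

text \<open>The one ingredient of the diagonal function that is not explicit pairing.\<close>

lemma Fn_code_num: "Fn f \<Longrightarrow> Fn (\<lambda>e. code_tm (num (f e)))"
proof -
  have "code_tm (num n) = rec_nat cZero (\<lambda>y r. cSucc r) n" for n by (induction n) auto
  moreover have "Fn (\<lambda>e. rec_nat cZero (\<lambda>y r. cSucc r) (f e))" if "Fn f"
    by (intro Fn_rec Sig_intros that)
  ultimately show "Fn f \<Longrightarrow> Fn (\<lambda>e. code_tm (num (f e)))" by simp
qed

text \<open>A theory with contradictory theorems admits no valuation.\<close>

lemma inconsistent_proves: "\<not> consistent T \<Longrightarrow> T \<turnstile> \<phi>"
  unfolding consistent_def using pval_thm pval_simps(1) by (metis pval_complete)

theorem rosser: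
  assumes T: "extends_Q T" "consistent T" "recursive_set (code_fm ` T)"
  shows "\<exists>\<sigma>. sentence \<sigma> \<and> \<not> T \<turnstile> \<sigma> \<and> \<not> T \<turnstile> Neg \<sigma>"
proof -
  note Sig_thm = Sig_theorem_code[OF recursive_set_Sig[OF T(3)]]
  \<comment> \<open>\<open>n\<close> occurs both as the code of the body and, through its numeral,
    as the number spoken about.\<close>
  let ?diag = "\<lambda>n. cAll (cImp (cEq (cVar 0) (code_tm (num n))) n)"
  have "Sig (\<lambda>e. theorem_code T (cNeg (?diag (e 0))))" "Sig (\<lambda>e. theorem_code T (?diag (e 0)))"
    by (intro Sig_thm Sig_intros Fn_code_num)+
  moreover have "\<not> (theorem_code T (cNeg n) \<and> theorem_code T n)" for n
  proof
    assume *: "theorem_code T (cNeg n) \<and> theorem_code T n"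
    then obtain \<phi> where "n = code_fm \<phi>" "T \<turnstile> \<phi>" unfolding theorem_code_def by blast
    moreover from this * have "T \<turnstile> Neg \<phi>" using theorem_code_iff[of T "Neg \<phi>"] by simp
    ultimately show False using T(2) unfolding consistent_def by blast
  qed
  ultimately obtain \<phi> where \<phi>:
    "\<And>e. theorem_code T (cNeg (?diag (e 0))) \<Longrightarrow> Q \<turnstile> msub 0 e \<phi>"
    "\<And>e. theorem_code T (?diag (e 0)) \<Longrightarrow> Q \<turnstile> Neg (msub 0 e \<phi>)"
    using separation[of "\<lambda>e. theorem_code T (cNeg (?diag (e 0)))" "\<lambda>e. theorem_code T (?diag (e 0))"] by blast
  \<comment> \<open>\<open>\<phi>\<close> may have further free variables; setting them to 0 leaves
    variable 0 as the only one, so that \<open>\<sigma>\<close> is closed.\<close>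
  define \<alpha> where "\<alpha> = msub 1 (\<lambda>_. 0) \<phi>"
  define n where "n = code_fm \<alpha>"
  define \<sigma> where "\<sigma> = All (Imp (Eq (Var 0) (num n)) \<alpha>)"
  have fv: "fv \<alpha> \<subseteq> {0}" using fv_msub[of 1 "\<lambda>_. 0" \<phi>] by (auto simp: \<alpha>_def)
  then have sent: "sentence \<sigma>" by (auto simp: sentence_def \<sigma>_def)
  have inst: "subst 0 (num n) \<alpha> = msub 0 (n \<triangleright> (\<lambda>_. 0)) \<phi>"
    by (simp add: \<alpha>_def subst_msub)
  have diag: "?diag n = code_fm \<sigma>" by (simp add: \<sigma>_def n_def)
  have "\<not> T \<turnstile> \<sigma>"
  proof
    assume \<sigma>: "T \<turnstile> \<sigma>"
    then have "theorem_code T (?diag n)" unfolding diag theorem_code_iff .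
    then have "T \<turnstile> Neg (subst 0 (num n) \<alpha>)"
      using Q_mono[OF \<phi>(2)[of "n \<triangleright> (\<lambda>_. 0)"] T(1)] unfolding inst by simp
    moreover have "T \<turnstile> subst 0 (num n) \<alpha>"
      using All_inst[OF \<sigma>[unfolded \<sigma>_def], of "num n"] proves.MP[OF _ proves.Ax_refl] by simp
    ultimately show False using T(2) unfolding consistent_def by blast
  qed
  moreover have "\<not> T \<turnstile> Neg \<sigma>"
  proof
    assume neg: "T \<turnstile> Neg \<sigma>"
    then have "theorem_code T (code_fm (Neg \<sigma>))" unfolding theorem_code_iff .
    then have "theorem_code T (cNeg (?diag n))" unfolding diag by simp
    then have *: "T \<turnstile> subst 0 (num n) \<alpha>"
      using Q_mono[OF \<phi>(1)[of "n \<triangleright> (\<lambda>_. 0)"] T(1)] unfolding inst by simp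
    \<comment> \<open>Under the guard, \<open>\<alpha>\<close> at the variable amounts to
      \<open>\<alpha>\<close> at \<open>n\<close>, which is already proved.\<close>
    have "T \<turnstile> Imp (Eq (Var 0) (num n)) \<alpha>"
    proof (rule pval_complete)
      fix v assume v: "pval T v"
      then show "v (Imp (Eq (Var 0) (num n)) \<alpha>)"
        using pval_eq_num[OF v _ fv] pval_thm[OF v *] by (simp add: pval_simps)
    qed
    then have "T \<turnstile> \<sigma>" unfolding \<sigma>_def by (rule proves.Gen)
    then show False using T(2) neg unfolding consistent_def by blast
  qed
  ultimately show ?thesis using sent by blast
qed

lemma Q_sentence: "\<phi> \<in> Q \<Longrightarrow> sentence \<phi>"
  by (auto simp: robinson_Q_def sentence_def Ex_def Iff_def Conj_def)

theorem corollary5: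
  fixes T :: "fm set"
  assumes "theory_of_sentences T"
    and "consistent T"
    and "recursively_axiomatizable T"
    and "extends_Q T"
  shows "\<exists>\<sigma>. sentence \<sigma> \<and> \<not> T \<turnstile> \<sigma> \<and> \<not> T \<turnstile> Neg \<sigma>"
proof -
  obtain T' where T': "recursive_set (code_fm ` T')" "theorems_of T' = theorems_of T"
    using assms(3) unfolding recursively_axiomatizable_def by blast
  have same: "T' \<turnstile> \<phi> \<longleftrightarrow> T \<turnstile> \<phi>" if "sentence \<phi>" for \<phi>
    using T'(2) that unfolding theorems_of_def by blast
  have "extends_Q T'"
    using assms(4) same Q_sentence unfolding extends_Q_def by blast
  moreover have "consistent T'"
  proof (rule ccontr)
    \<comment> \<open>The contradiction may lie in open formulas, while the theories are known to
      agree on sentences only; explosion moves it to a closed formula.\<close>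
    assume "\<not> consistent T'"
    then have "T \<turnstile> Eq Zero Zero" "T \<turnstile> Neg (Eq Zero Zero)"
      using inconsistent_proves same by (auto simp: sentence_def)
    then show False using assms(2) unfolding consistent_def by blast
  qed
  ultimately obtain \<sigma> where "sentence \<sigma>" "\<not> T' \<turnstile> \<sigma>" "\<not> T' \<turnstile> Neg \<sigma>"
    using rosser T'(1) by blast
  moreover have "sentence (Neg \<sigma>)" using \<open>sentence \<sigma>\<close> by (simp add: sentence_def)
  ultimately show ?thesis using same by blast
qed

end
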